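(* Let $G=(V,E)$ be a disconnected graph with $|E|\geq 1$. Then the following statements are equivalent: (a) $I_G$ is generated in a single degree; (b) $I_G$ is generated by linear forms; (c) $G=K_2\sqcup\bigl(\bigsqcup_{i=1}^t K_1\bigr)$ or $G=K_3\sqcup\bigl(\bigsqcup_{i=1}^t K_1\bigr)$ for some $t\geq 1$ (up to isomorphism).
   Context: $\mathbb{K}$ is a field. All graphs are finite and simple with non-empty vertex set. $K_n$ is the complete graph on $n$ vertices and $\sqcup$ denotes disjoint union of graphs. For a graph $G=(V,E)$ let $S_G=\mathbb{K}[q_{A|B}]$ be the polynomial ring with one variable for each unordered partition $A|B$ of $V$ (i.e. $A\cup B=V$, $A\cap B=\emptyset$, empty parts allowed), standard graded, and $R_G=\mathbb{K}[s_{ij},t_{ij}:\{i,j\}\in E]$. Let $\mathrm{Cut}(A|B)\subseteq E$ be the set of edges with one endpoint in $A$ and the other in $B$. Let $\phi_G\colon S_G\to R_G$ be the $\mathbb{K}$-algebra homomorphism $q_{A|B}\mapsto \prod_{\{i,j\}\in \mathrm{Cut}(A|B)}s_{ij}\prod_{\{i,j\}\in E\setminus \mathrm{Cut}(A|B)}t_{ij}$. The cut ideal is the graded ideal $I_G=\ker\phi_G$. *)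

theory Defs
  imports "HOL-Algebra.RingHom" "HOL-Library.Poly_Mapping"
begin

section \<open>Finite simple graphs\<close>

record 'v ugraph =
  verts :: "'v set"
  edges :: "'v set set"

definition simple_graph :: "'v ugraph \<Rightarrow> bool" where
  "simple_graph G \<longleftrightarrow> finite (verts G) \<and> verts G \<noteq> {} \<and>
     (\<forall>e\<in>edges G. e \<subseteq> verts G \<and> card e = 2)"

definition connected_graph :: "'v ugraph \<Rightarrow> bool" where
  "connected_graph G \<longleftrightarrow>
     (\<forall>u\<in>verts G. \<forall>v\<in>verts G. (u, v) \<in> {(x, y). {x, y} \<in> edges G}\<^sup>*)"

definition complete_graph :: "nat \<Rightarrow> nat ugraph" where
  "complete_graph n = \<lparr>verts = {..<n}, edges = {e. e \<subseteq> {..<n} \<and> card e = 2}\<rparr>"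

definition disjoint_sum :: "'a ugraph \<Rightarrow> 'b ugraph \<Rightarrow> ('a + 'b) ugraph" where
  "disjoint_sum G H =
     \<lparr>verts = verts G <+> verts H,
      edges = (`) Inl ` edges G \<union> (`) Inr ` edges H\<rparr>"

definition disjoint_family_sum :: "'i set \<Rightarrow> ('i \<Rightarrow> 'a ugraph) \<Rightarrow> ('i \<times> 'a) ugraph" where
  "disjoint_family_sum I F =
     \<lparr>verts = (SIGMA i:I. verts (F i)),
      edges = (\<Union>i\<in>I. (`) (Pair i) ` edges (F i))\<rparr>"

definition graph_iso :: "'a ugraph \<Rightarrow> 'b ugraph \<Rightarrow> bool" where
  "graph_iso G H \<longleftrightarrow>
     (\<exists>f. bij_betw f (verts G) (verts H) \<and>
          (\<forall>u\<in>verts G. \<forall>v\<in>verts G. {u, v} \<in> edges G \<longleftrightarrow> {f u, f v} \<in> edges H))"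


section \<open>Polynomial rings\<close>

text \<open>A polynomial maps each monomial, i.e. each finitely supported family of exponents, to its
  coefficient; addition and multiplication are those of \<^theory>\<open>HOL-Library.Poly_Mapping\<close>.
  The polynomial ring in a set \<^term>\<open>X\<close> of variables is a record, since notions such as
  ``ideal'' depend on \<^term>\<open>X\<close>.\<close>

type_synonym ('x, 'k) polynomial = "('x \<Rightarrow>\<^sub>0 nat) \<Rightarrow>\<^sub>0 'k"

definition indets :: "('x, 'k::zero) polynomial \<Rightarrow> 'x set" where
  "indets p = (\<Union>m\<in>Poly_Mapping.keys p. Poly_Mapping.keys m)"

definition const :: "'k::zero \<Rightarrow> ('x, 'k) polynomial" where
  "const c = Poly_Mapping.single 0 c"

definition var :: "'x \<Rightarrow> ('x, 'k::zero_neq_one) polynomial" where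
  "var x = Poly_Mapping.single (Poly_Mapping.single x 1) 1"

definition poly_ring :: "'x set \<Rightarrow> ('x, 'k::field) polynomial ring" where
  "poly_ring X =
     \<lparr>carrier = {p. indets p \<subseteq> X}, mult = (*), one = 1, zero = 0, add = (+)\<rparr>"

text \<open>The algebra homomorphism that sends each variable \<^term>\<open>x\<close> to \<^term>\<open>f x\<close>.\<close>

definition poly_subst :: "('x \<Rightarrow> ('y, 'k::field) polynomial) \<Rightarrow> ('x, 'k) polynomial
    \<Rightarrow> ('y, 'k) polynomial" where
  "poly_subst f p = (\<Sum>m\<in>Poly_Mapping.keys p.
     const (Poly_Mapping.lookup p m) *
       (\<Prod>x\<in>Poly_Mapping.keys m. f x ^ Poly_Mapping.lookup m x))"

lemma cring_poly_ring: "cring (poly_ring X)"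
proof (intro cringI abelian_groupI comm_monoidI)
  have add: "indets (p + q) \<subseteq> X" if "indets p \<subseteq> X" "indets q \<subseteq> X"
    for p q :: "('a, 'b) polynomial"
    using that Poly_Mapping.keys_add[of p q] unfolding indets_def by blast
  have mult: "indets (p * q) \<subseteq> X" if "indets p \<subseteq> X" "indets q \<subseteq> X"
    for p q :: "('a, 'b) polynomial"
  proof
    fix x assume "x \<in> indets (p * q)"
    then obtain m where m: "m \<in> Poly_Mapping.keys (p * q)" "x \<in> Poly_Mapping.keys m"
      by (auto simp: indets_def)
    then obtain a b where "a \<in> Poly_Mapping.keys p" "b \<in> Poly_Mapping.keys q" "m = a + b"
      using keys_mult[of p q] by blast
    moreover from this m(2) have "x \<in> Poly_Mapping.keys a \<union> Poly_Mapping.keys b"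
      using Poly_Mapping.keys_add[of a b] by blast
    ultimately show "x \<in> X" using that by (auto simp: indets_def)
  qed
  fix p q :: "('a, 'b) polynomial"
  assume p: "p \<in> carrier (poly_ring X)"
  then show "\<exists>y\<in>carrier (poly_ring X). y \<oplus>\<^bsub>poly_ring X\<^esub> p = \<zero>\<^bsub>poly_ring X\<^esub>"
    by (intro bexI[of _ "- p"]) (auto simp: poly_ring_def indets_def in_keys_iff)
  assume q: "q \<in> carrier (poly_ring X)"
  show "p \<oplus>\<^bsub>poly_ring X\<^esub> q \<in> carrier (poly_ring X)"
    using add p q by (simp add: poly_ring_def)
  show "p \<otimes>\<^bsub>poly_ring X\<^esub> q \<in> carrier (poly_ring X)"
    using mult p q by (simp add: poly_ring_def)
qed (auto simp: poly_ring_def indets_def algebra_simps)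

lemma poly_subst_superset:
  assumes "finite A" "Poly_Mapping.keys p \<subseteq> A"
  shows "poly_subst f p = (\<Sum>m\<in>A. const (Poly_Mapping.lookup p m) *
    (\<Prod>x\<in>Poly_Mapping.keys m. f x ^ Poly_Mapping.lookup m x))"
  unfolding poly_subst_def using assms
  by (intro sum.mono_neutral_left) (auto simp: const_def in_keys_iff)

lemma poly_subst_add: "poly_subst f (p + q) = poly_subst f p + poly_subst f q"
proof -
  let ?A = "Poly_Mapping.keys p \<union> Poly_Mapping.keys q"
  show ?thesis
    using Poly_Mapping.keys_add[of p q]
    by (simp add: poly_subst_superset[of ?A] lookup_add const_def single_add
        ring_distribs sum.distrib)
qed

lemma poly_subst_zero [simp]: "poly_subst f 0 = 0"
  by (simp add: poly_subst_def)

lemma poly_subst_sum: "poly_subst f (\<Sum>i\<in>A. g i) = (\<Sum>i\<in>A. poly_subst f (g i))"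
  by (induction A rule: infinite_finite_induct) (simp_all add: poly_subst_add)

lemma poly_subst_single: "poly_subst f (Poly_Mapping.single m c) =
    const c * (\<Prod>x\<in>Poly_Mapping.keys m. f x ^ Poly_Mapping.lookup m x)"
  by (cases "c = 0") (simp_all add: poly_subst_def const_def)

lemma polynomial_sum_single:
  "p = (\<Sum>m\<in>Poly_Mapping.keys p. Poly_Mapping.single m (Poly_Mapping.lookup p m))"
  by (intro poly_mapping_eqI)
    (auto simp: lookup_sum lookup_single when_def in_keys_iff sum.If_cases sum.delta)

lemma monomial_value_add:
  fixes f :: "'x \<Rightarrow> ('y, 'k::field) polynomial"
  shows "(\<Prod>x\<in>Poly_Mapping.keys (m + n). f x ^ Poly_Mapping.lookup (m + n) x) =
   (\<Prod>x\<in>Poly_Mapping.keys m. f x ^ Poly_Mapping.lookup m x) *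
   (\<Prod>x\<in>Poly_Mapping.keys n. f x ^ Poly_Mapping.lookup n x)"
proof -
  let ?A = "Poly_Mapping.keys m \<union> Poly_Mapping.keys n"
  have *: "(\<Prod>x\<in>Poly_Mapping.keys k. f x ^ Poly_Mapping.lookup k x) =
      (\<Prod>x\<in>?A. f x ^ Poly_Mapping.lookup k x)" if "Poly_Mapping.keys k \<subseteq> ?A" for k
    using that by (intro prod.mono_neutral_left) (auto simp: in_keys_iff)
  show ?thesis
    unfolding *[OF Poly_Mapping.keys_add] *[OF Un_upper1] *[OF Un_upper2]
    by (simp add: lookup_add power_add prod.distrib)
qed

lemma poly_subst_mult:
  fixes f :: "'x \<Rightarrow> ('y, 'k::field) polynomial"
  shows "poly_subst f (p * q) = poly_subst f p * poly_subst f q"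
proof -
  have single: "poly_subst f (Poly_Mapping.single m c * Poly_Mapping.single n d) =
    poly_subst f (Poly_Mapping.single m c) * poly_subst f (Poly_Mapping.single n d)" for m n c d
  proof -
    have "(const (c * d) :: ('y, 'k) polynomial) = const c * const d"
      by (simp add: const_def mult_single)
    then show ?thesis
      by (simp add: mult_single poly_subst_single monomial_value_add mult_ac)
  qed
  have "poly_subst f ((\<Sum>m\<in>Poly_Mapping.keys p. Poly_Mapping.single m (Poly_Mapping.lookup p m)) *
      (\<Sum>m\<in>Poly_Mapping.keys q. Poly_Mapping.single m (Poly_Mapping.lookup q m))) =
    poly_subst f (\<Sum>m\<in>Poly_Mapping.keys p. Poly_Mapping.single m (Poly_Mapping.lookup p m)) *
      poly_subst f (\<Sum>m\<in>Poly_Mapping.keys q. Poly_Mapping.single m (Poly_Mapping.lookup q m))"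
    by (simp only: sum_product poly_subst_sum single)
  then show ?thesis
    by (simp flip: polynomial_sum_single)
qed

lemma poly_subst_const [simp]: "poly_subst f (const c) = const c"
  by (simp add: const_def poly_subst_single[of f 0 c])

lemma poly_subst_var [simp]: "poly_subst f (var x) = f x"
  by (simp add: var_def poly_subst_single const_def)

lemma const_in_poly_ring: "const c \<in> carrier (poly_ring X)"
  by (simp add: poly_ring_def const_def indets_def)

lemma poly_subst_ring_hom:
  fixes f :: "'x \<Rightarrow> ('y, 'k::field) polynomial"
  assumes "\<And>x. x \<in> X \<Longrightarrow> f x \<in> carrier (poly_ring Y)"
  shows "poly_subst f \<in> ring_hom (poly_ring X) (poly_ring Y)"
proof (rule ring_hom_memI)
  interpret Y: cring "poly_ring Y" by (rule cring_poly_ring)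
  have mult: "a * b \<in> carrier (poly_ring Y)"
    if "a \<in> carrier (poly_ring Y)" "b \<in> carrier (poly_ring Y)" for a b :: "('y, 'k) polynomial"
    using Y.m_closed[OF that] by (simp add: poly_ring_def)
  have add: "a + b \<in> carrier (poly_ring Y)"
    if "a \<in> carrier (poly_ring Y)" "b \<in> carrier (poly_ring Y)" for a b :: "('y, 'k) polynomial"
    using Y.a_closed[OF that] by (simp add: poly_ring_def)
  have one: "(1 :: ('y, 'k) polynomial) \<in> carrier (poly_ring Y)"
    using Y.one_closed by (simp add: poly_ring_def)
  have zero: "(0 :: ('y, 'k) polynomial) \<in> carrier (poly_ring Y)"
    using Y.zero_closed by (simp add: poly_ring_def)
  have pow: "a ^ n \<in> carrier (poly_ring Y)"
    if "a \<in> carrier (poly_ring Y)" for a :: "('y, 'k) polynomial" and n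
    by (induction n) (use that one mult in auto)
  have prods: "(\<Prod>i\<in>A. g i) \<in> carrier (poly_ring Y)"
    if "\<And>i. i \<in> A \<Longrightarrow> g i \<in> carrier (poly_ring Y)"
    for A :: "'x set" and g :: "'x \<Rightarrow> ('y, 'k) polynomial"
    using that by (induction A rule: infinite_finite_induct) (auto intro: mult one)
  have sums: "(\<Sum>i\<in>A. g i) \<in> carrier (poly_ring Y)"
    if "\<And>i. i \<in> A \<Longrightarrow> g i \<in> carrier (poly_ring Y)"
    for A :: "('x \<Rightarrow>\<^sub>0 nat) set" and g :: "_ \<Rightarrow> ('y, 'k) polynomial"
    using that by (induction A rule: infinite_finite_induct) (auto intro: add zero)
  fix p :: "('x, 'k) polynomial"
  assume "p \<in> carrier (poly_ring X)"
  then show "poly_subst f p \<in> carrier (poly_ring Y)"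
    unfolding poly_subst_def
    by (intro sums mult prods pow const_in_poly_ring assms)
      (auto simp: poly_ring_def indets_def)
next
  have "poly_subst f 1 = 1"
    using poly_subst_const[of f 1] by (simp add: const_def)
  then show "poly_subst f \<one>\<^bsub>poly_ring X\<^esub> = \<one>\<^bsub>poly_ring Y\<^esub>"
    by (simp add: poly_ring_def)
qed (simp_all add: poly_ring_def poly_subst_add poly_subst_mult)

definition total_degree :: "('x \<Rightarrow>\<^sub>0 nat) \<Rightarrow> nat" where
  "total_degree m = (\<Sum>x\<in>Poly_Mapping.keys m. Poly_Mapping.lookup m x)"

text \<open>As usual, the zero polynomial is homogeneous of every degree.\<close>

definition homogeneous :: "nat \<Rightarrow> ('x, 'k::zero) polynomial \<Rightarrow> bool" where
  "homogeneous d p \<longleftrightarrow> (\<forall>m\<in>Poly_Mapping.keys p. total_degree m = d)"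

definition linear_form :: "('x, 'k::zero) polynomial \<Rightarrow> bool" where
  "linear_form p \<longleftrightarrow> homogeneous 1 p"

definition generated_in_single_degree ::
    "'x set \<Rightarrow> ('x, 'k::field) polynomial set \<Rightarrow> bool" where
  "generated_in_single_degree X I \<longleftrightarrow>
     (\<exists>d. \<exists>F \<subseteq> carrier (poly_ring X). (\<forall>f\<in>F. homogeneous d f) \<and> I = Idl\<^bsub>poly_ring X\<^esub> F)"

definition generated_by_linear_forms ::
    "'x set \<Rightarrow> ('x, 'k::field) polynomial set \<Rightarrow> bool" where
  "generated_by_linear_forms X I \<longleftrightarrow>
     (\<exists>F \<subseteq> carrier (poly_ring X). (\<forall>f\<in>F. linear_form f) \<and> I = Idl\<^bsub>poly_ring X\<^esub> F)"


section \<open>Cut ideals\<close>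

text \<open>The unordered partition $A|B$ is represented by the set \<^term>\<open>{A, B}\<close>.\<close>

definition unordered_partitions :: "'v set \<Rightarrow> 'v set set set" where
  "unordered_partitions V = {{A, B} | A B. A \<union> B = V \<and> A \<inter> B = {}}"

definition cut_edges :: "'v ugraph \<Rightarrow> 'v set set \<Rightarrow> 'v set set" where
  "cut_edges G P = {e \<in> edges G. \<exists>A B a b. P = {A, B} \<and> a \<in> A \<and> b \<in> B \<and> e = {a, b}}"

datatype 'e st_var = S_var 'e | T_var 'e

definition st_vars :: "'v ugraph \<Rightarrow> 'v set st_var set" where
  "st_vars G = S_var ` edges G \<union> T_var ` edges G"

definition cut_monomial :: "'v ugraph \<Rightarrow> 'v set set \<Rightarrow> ('v set st_var, 'k::field) polynomial" where
  "cut_monomial G P = (\<Prod>e\<in>cut_edges G P. var (S_var e)) * (\<Prod>e\<in>edges G - cut_edges G P. var (T_var e))"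

definition cut_map :: "'v ugraph \<Rightarrow> ('v set set, 'k::field) polynomial
    \<Rightarrow> ('v set st_var, 'k) polynomial" where
  "cut_map G = poly_subst (cut_monomial G)"

definition cut_ideal :: "'v ugraph \<Rightarrow> ('v set set, 'k::field) polynomial set" where
  "cut_ideal G =
     a_kernel (poly_ring (unordered_partitions (verts G))) (poly_ring (st_vars G)) (cut_map G)"

lemma cut_monomial_in_poly_ring: "cut_monomial G P \<in> carrier (poly_ring (st_vars G))"
proof -
  interpret R: cring "poly_ring (st_vars G) :: ('a set st_var, 'b) polynomial ring"
    by (rule cring_poly_ring)
  have mult: "a * b \<in> carrier (poly_ring (st_vars G))"
    if "a \<in> carrier (poly_ring (st_vars G))" "b \<in> carrier (poly_ring (st_vars G))"
    for a b :: "('a set st_var, 'b) polynomial"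
    using R.m_closed[OF that] by (simp add: poly_ring_def)
  have one: "(1 :: ('a set st_var, 'b) polynomial) \<in> carrier (poly_ring (st_vars G))"
    using R.one_closed by (simp add: poly_ring_def)
  have prods: "(\<Prod>e\<in>A. g e) \<in> carrier (poly_ring (st_vars G))"
    if "\<And>e. e \<in> A \<Longrightarrow> g e \<in> carrier (poly_ring (st_vars G))"
    for A :: "'a set set" and g :: "_ \<Rightarrow> ('a set st_var, 'b) polynomial"
    using that by (induction A rule: infinite_finite_induct) (auto intro: mult one)
  have var: "(var x :: ('a set st_var, 'b) polynomial) \<in> carrier (poly_ring (st_vars G))"
    if "x \<in> st_vars G" for x
    using that by (simp add: poly_ring_def var_def indets_def)
  show ?thesis
    unfolding cut_monomial_def
    by (intro mult prods var) (auto simp: st_vars_def cut_edges_def)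
qed

lemma cut_map_ring_hom:
  "cut_map G \<in> ring_hom (poly_ring (unordered_partitions (verts G))) (poly_ring (st_vars G))"
  unfolding cut_map_def by (intro poly_subst_ring_hom cut_monomial_in_poly_ring)

lemma cut_edges_partition:
  assumes "A \<inter> B = {}"
  shows "cut_edges G {A, B} = {e \<in> edges G. \<exists>a\<in>A. \<exists>b\<in>B. e = {a, b}}"
  using assms by (fastforce simp: cut_edges_def doubleton_eq_iff)

lemma ideal_cut_ideal: "ideal (cut_ideal G) (poly_ring (unordered_partitions (verts G)))"
  unfolding cut_ideal_def
  by (intro ring_hom_ring.kernel_is_ideal ring_hom_ringI2 cut_map_ring_hom
      cring.axioms(1) cring_poly_ring)

end

theory Submission
  imports Defs
begin

text \<open>Write \<open>q\<^sub>A\<close> for the variable of the partition of \<open>V\<close> into \<open>A\<close> and its complement. A linear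
  form of the cut ideal \<open>I\<close> has coefficients that sum to zero over every set of partitions with
  the same cut, so if \<open>I\<close> is generated by linear forms, then it is killed by the substitution
  that sends the partitions with empty cut to \<open>0\<close> and all others to \<open>1\<close>. If \<open>u\<close> and \<open>v\<close> are
  non-adjacent and not isolated, this fails for
  \<open>q\<^sub>\<emptyset> q\<^sub>u\<^sub>v - q\<^sub>u q\<^sub>v \<in> I\<close>; if \<open>a\<close>, \<open>b\<close>, \<open>c\<close> are not isolated and some edge leaves \<open>{a, b, c}\<close>,
  it fails for \<open>q\<^sub>\<emptyset> q\<^sub>a\<^sub>b q\<^sub>a\<^sub>c q\<^sub>b\<^sub>c - q\<^sub>a q\<^sub>b q\<^sub>c q\<^sub>a\<^sub>b\<^sub>c \<in> I\<close>. What remains is that the non-isolated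
  vertices form a \<open>K\<^sub>2\<close> or a \<open>K\<^sub>3\<close>. In that case any two distinct cuts differ in the same
  number \<open>s > 0\<close> of edges, which allows one to recover a monomial, up to partitions with equal
  cuts, from its image; hence \<open>I\<close> is generated by the differences of two variables with the
  same cut. Finally, in a disconnected graph a component and the empty set have the same cut, so
  \<open>I\<close> contains a non-zero linear form and can be generated in no degree other than \<open>1\<close>.\<close>

section \<open>Polynomial rings\<close>

lemma poly_ring_simps [simp]:
  "p \<otimes>\<^bsub>poly_ring X\<^esub> q = p * q" "p \<oplus>\<^bsub>poly_ring X\<^esub> q = p + q"
  "\<zero>\<^bsub>poly_ring X\<^esub> = 0" "\<one>\<^bsub>poly_ring X\<^esub> = 1"
  by (simp_all add: poly_ring_def)

lemma poly_ring_uminus_closed: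
  "p \<in> carrier (poly_ring X) \<Longrightarrow> - p \<in> carrier (poly_ring X)"
  by (simp add: poly_ring_def indets_def)

lemma poly_ring_closed:
  assumes "p \<in> carrier (poly_ring X)" "q \<in> carrier (poly_ring X)"
  shows "p * q \<in> carrier (poly_ring X)" "p + q \<in> carrier (poly_ring X)"
    "p - q \<in> carrier (poly_ring X)"
proof -
  interpret cring "poly_ring X :: ('a, 'b) polynomial ring" by (rule cring_poly_ring)
  show "p * q \<in> carrier (poly_ring X)" "p + q \<in> carrier (poly_ring X)"
    using m_closed[OF assms] a_closed[OF assms] by simp_all
  show "p - q \<in> carrier (poly_ring X)"
    using a_closed[OF assms(1) poly_ring_uminus_closed[OF assms(2)]] by simp
qed

lemma zero_in_poly_ring: "0 \<in> carrier (poly_ring X)"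
  by (simp add: poly_ring_def indets_def)

lemma one_in_poly_ring: "1 \<in> carrier (poly_ring X)"
  by (simp add: poly_ring_def indets_def)

lemma var_in_poly_ring: "x \<in> X \<Longrightarrow> var x \<in> carrier (poly_ring X)"
  by (simp add: poly_ring_def var_def indets_def)

lemma poly_ring_uminus:
  assumes "p \<in> carrier (poly_ring X)"
  shows "\<ominus>\<^bsub>poly_ring X\<^esub> p = - p"
proof -
  interpret cring "poly_ring X :: ('a, 'b) polynomial ring" by (rule cring_poly_ring)
  show ?thesis
    by (rule minus_equality) (use assms poly_ring_uminus_closed in auto)
qed

lemma poly_subst_uminus: "poly_subst f (- p) = - poly_subst f p"
  using poly_subst_add[of f p "- p"] by (simp add: eq_neg_iff_add_eq_0 add.commute)

lemma poly_subst_diff: "poly_subst f (p - q) = poly_subst f p - poly_subst f q"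
  using poly_subst_add[of f p "- q"] by (simp add: poly_subst_uminus)

lemma ideal_poly_ringI:
  assumes "J \<subseteq> carrier (poly_ring X)" "0 \<in> J"
    and add: "\<And>p q. p \<in> J \<Longrightarrow> q \<in> J \<Longrightarrow> p + q \<in> J"
    and mult: "\<And>p q. p \<in> J \<Longrightarrow> q \<in> carrier (poly_ring X) \<Longrightarrow> p * q \<in> J"
  shows "ideal J (poly_ring X)"
proof -
  interpret cring "poly_ring X :: ('a, 'b) polynomial ring" by (rule cring_poly_ring)
  have "\<ominus>\<^bsub>poly_ring X\<^esub> p \<in> J" if "p \<in> J" for p
    using mult[OF that poly_ring_uminus_closed[OF one_in_poly_ring]]
      that assms(1) poly_ring_uminus[of p X] by auto
  then have "subgroup J (add_monoid (poly_ring X))"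
    by (intro add.subgroupI)
      (use assms in \<open>auto simp flip: a_inv_def\<close>)
  then show ?thesis
    using mult by (intro idealI) (auto simp: ring_axioms mult.commute)
qed

lemma ideal_poly_ringD:
  assumes "ideal J (poly_ring X)" "p \<in> J"
  shows "q \<in> J \<Longrightarrow> p + q \<in> J" "q \<in> carrier (poly_ring X) \<Longrightarrow> q * p \<in> J" "- p \<in> J"
    "p \<in> carrier (poly_ring X)"
proof -
  interpret ideal J "poly_ring X" by fact
  show "q \<in> J \<Longrightarrow> p + q \<in> J" "q \<in> carrier (poly_ring X) \<Longrightarrow> q * p \<in> J"
    using additive_subgroup.a_closed[OF additive_subgroup_axioms, of p q] I_l_closed[of p q] assms(2) by simp_all
  show c: "p \<in> carrier (poly_ring X)"
    using assms(2) a_Hcarr by blast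
  show "- p \<in> J"
    using additive_subgroup.a_inv_closed[OF additive_subgroup_axioms assms(2)] poly_ring_uminus[OF c] by simp
qed

section \<open>Substitution of monomials for variables\<close>

lemma prod_single_one:
  "(\<Prod>x\<in>A. Poly_Mapping.single (a x) 1) =
    (Poly_Mapping.single (\<Sum>x\<in>A. a x) 1 :: ('x, 'k::comm_ring_1) polynomial)"
  by (induction A rule: infinite_finite_induct) (simp_all add: mult_single)

lemma single_one_power:
  "Poly_Mapping.single w 1 ^ n =
    (Poly_Mapping.single (\<Sum>i<n. w) 1 :: ('x, 'k::comm_ring_1) polynomial)"
  using prod_single_one[of "\<lambda>_. w" "{..<n}"] by simp

text \<open>The exponent vector of the image of the monomial \<open>m\<close> when every variable
  \<open>x\<close> is replaced by the monomial with exponent vector \<open>e x\<close>. The inner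
  sum is the \<open>lookup m x\<close>-fold multiple of \<open>e x\<close>.\<close>

definition monomial_exponent ::
    "('x \<Rightarrow> ('y \<Rightarrow>\<^sub>0 nat)) \<Rightarrow> ('x \<Rightarrow>\<^sub>0 nat) \<Rightarrow> ('y \<Rightarrow>\<^sub>0 nat)" where
  "monomial_exponent e m = (\<Sum>x\<in>Poly_Mapping.keys m. \<Sum>i<Poly_Mapping.lookup m x. e x)"

lemma lookup_monomial_exponent:
  "Poly_Mapping.lookup (monomial_exponent e m) y =
    (\<Sum>x\<in>Poly_Mapping.keys m. Poly_Mapping.lookup m x * Poly_Mapping.lookup (e x) y)"
  by (simp add: monomial_exponent_def lookup_sum)

lemma monomial_exponent_single_one [simp]:
  "monomial_exponent e (Poly_Mapping.single x 1) = e x"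
  by (rule poly_mapping_eqI) (simp add: lookup_monomial_exponent)

lemma poly_subst_monomial:
  assumes "\<And>x. f x = Poly_Mapping.single (e x) 1"
  shows "poly_subst f (Poly_Mapping.single m c) =
    Poly_Mapping.single (monomial_exponent e m) (c :: 'k::field)"
  by (simp add: poly_subst_single assms single_one_power prod_single_one
      monomial_exponent_def const_def mult_single)

lemma poly_subst_monomial_sum:
  assumes "\<And>x. f x = Poly_Mapping.single (e x) 1"
  shows "poly_subst f p = (\<Sum>n\<in>Poly_Mapping.keys p.
    Poly_Mapping.single (monomial_exponent e n) (Poly_Mapping.lookup p n :: 'k::field))"
proof -
  have "poly_subst f (\<Sum>n\<in>Poly_Mapping.keys p. Poly_Mapping.single n (Poly_Mapping.lookup p n)) =
      (\<Sum>n\<in>Poly_Mapping.keys p.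
        Poly_Mapping.single (monomial_exponent e n) (Poly_Mapping.lookup p n))"
    unfolding poly_subst_sum
    by (intro sum.cong refl poly_subst_monomial assms)
  then show ?thesis
    by (simp flip: polynomial_sum_single)
qed

text \<open>Replacing every variable by itself acts as the identity on exponent vectors, so this is
  \<open>poly_subst_monomial\<close> evaluated at \<open>var\<close>.\<close>

lemma single_eq_prod_var:
  "Poly_Mapping.single m (c::'k::field) =
    const c * (\<Prod>x\<in>Poly_Mapping.keys m. var x ^ Poly_Mapping.lookup m x)"
proof -
  have "monomial_exponent (\<lambda>x. Poly_Mapping.single x 1) m = m"
  proof (rule poly_mapping_eqI)
    fix y
    have "Poly_Mapping.lookup (monomial_exponent (\<lambda>x. Poly_Mapping.single x 1) m) y =
        (\<Sum>x\<in>Poly_Mapping.keys m. if x = y then Poly_Mapping.lookup m x else 0)"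
      unfolding lookup_monomial_exponent
      by (intro sum.cong) (auto simp: lookup_single when_def)
    then show "Poly_Mapping.lookup (monomial_exponent (\<lambda>x. Poly_Mapping.single x 1) m) y =
        Poly_Mapping.lookup m y"
      by (simp add: not_in_keys_iff_lookup_eq_zero)
  qed
  then show ?thesis
    using poly_subst_monomial[of var "\<lambda>x. Poly_Mapping.single x 1" m c]
    by (simp add: poly_subst_single var_def)
qed

text \<open>A polynomial is a finite sum of constants times products of powers of variables, and
  only variables from \<open>X\<close> occur in its monomials.\<close>

lemma poly_ring_induct [consumes 1, case_names const var add mult]:
  assumes p: "p \<in> carrier (poly_ring X)"
    and const: "\<And>c. P (const c)"
    and var: "\<And>x. x \<in> X \<Longrightarrow> P (var x)"
    and add: "\<And>p q. \<lbrakk>p \<in> carrier (poly_ring X); q \<in> carrier (poly_ring X); P p; P q\<rbrakk> \<Longrightarrow> P (p + q)"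
    and mult: "\<And>p q. \<lbrakk>p \<in> carrier (poly_ring X); q \<in> carrier (poly_ring X); P p; P q\<rbrakk> \<Longrightarrow> P (p * q)"
  shows "P p"
proof -
  \<comment> \<open>Membership in the ring is carried along with \<open>P\<close>, because the
    hypotheses \<open>add\<close> and \<open>mult\<close> ask for it.\<close>
  define Q where "Q p \<longleftrightarrow> p \<in> carrier (poly_ring X) \<and> P p" for p
  have Q_const: "Q (const c)" for c
    using const by (simp add: Q_def const_in_poly_ring)
  have Q_var: "Q (var x)" if "x \<in> X" for x
    using that var by (simp add: Q_def var_in_poly_ring)
  have Q_add: "Q (p + q)" and Q_mult: "Q (p * q)" if "Q p" "Q q" for p q
    using that add mult poly_ring_closed by (auto simp: Q_def)
  have Q01: "Q 0" "Q 1"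
    using Q_const[of 0] Q_const[of 1] by (simp_all add: const_def)
  have Q_power: "Q (p ^ n)" if "Q p" for p n
    by (induction n) (use that Q_mult Q01 in auto)
  have Q_prod: "Q (\<Prod>x\<in>A. g x)" if "\<And>x. x \<in> A \<Longrightarrow> Q (g x)"
    for A :: "'a set" and g
    using that by (induction A rule: infinite_finite_induct) (auto intro: Q01 Q_mult)
  have Q_sum: "Q (\<Sum>x\<in>A. g x)" if "\<And>x. x \<in> A \<Longrightarrow> Q (g x)"
    for A :: "('a \<Rightarrow>\<^sub>0 nat) set" and g
    using that by (induction A rule: infinite_finite_induct) (auto intro: Q01 Q_add)
  have "Q (Poly_Mapping.single m (Poly_Mapping.lookup p m))"
    if "m \<in> Poly_Mapping.keys p" for m
    unfolding single_eq_prod_var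
    by (intro Q_mult Q_const Q_prod Q_power Q_var)
      (use p that in \<open>auto simp: poly_ring_def indets_def\<close>)
  then have "Q (\<Sum>m\<in>Poly_Mapping.keys p. Poly_Mapping.single m (Poly_Mapping.lookup p m))"
    by (rule Q_sum)
  then show ?thesis
    by (simp add: Q_def flip: polynomial_sum_single)
qed

text \<open>Distinct monomials of \<open>p\<close> have distinct images, so nothing cancels: the
  coefficient of the image of \<open>m\<close> in \<open>poly_subst f p\<close> equals the
  coefficient of \<open>m\<close> in \<open>p\<close>.\<close>

lemma poly_subst_monomial_inj:
  assumes f: "\<And>x. f x = Poly_Mapping.single (e x) 1"
    and inj: "inj_on (monomial_exponent e) (Poly_Mapping.keys p)"
    and zero: "poly_subst f p = (0 :: ('y, 'k::field) polynomial)"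
  shows "p = 0"
proof (rule ccontr)
  assume "p \<noteq> 0"
  then obtain m where m: "m \<in> Poly_Mapping.keys p"
    by (meson all_not_in_conv keys_eq_empty)
  have eq: "poly_subst f p = (\<Sum>n\<in>Poly_Mapping.keys p.
      Poly_Mapping.single (monomial_exponent e n) (Poly_Mapping.lookup p n))"
    by (rule poly_subst_monomial_sum) (rule f)
  have "Poly_Mapping.lookup (poly_subst f p) (monomial_exponent e m) =
      (\<Sum>n\<in>Poly_Mapping.keys p. if n = m then Poly_Mapping.lookup p n else 0)"
    unfolding eq lookup_sum
  proof (rule sum.cong)
    fix n assume "n \<in> Poly_Mapping.keys p"
    then have "monomial_exponent e n = monomial_exponent e m \<longleftrightarrow> n = m"
      using inj m by (auto dest: inj_onD)
    then show "Poly_Mapping.lookup (Poly_Mapping.single (monomial_exponent e n)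
        (Poly_Mapping.lookup p n)) (monomial_exponent e m) =
        (if n = m then Poly_Mapping.lookup p n else 0)"
      by (simp add: lookup_single when_def)
  qed simp
  then show False
    using m zero by (simp split: if_splits) (metis in_keys_iff)
qed

section \<open>Degrees\<close>

lemma total_degree_add: "total_degree (m + n) = total_degree m + total_degree n"
proof -
  let ?A = "Poly_Mapping.keys m \<union> Poly_Mapping.keys n"
  have *: "total_degree k = (\<Sum>x\<in>?A. Poly_Mapping.lookup k x)"
    if "Poly_Mapping.keys k \<subseteq> ?A" for k
    unfolding total_degree_def
    using that by (intro sum.mono_neutral_left) (auto simp: in_keys_iff)
  show ?thesis
    unfolding *[OF Poly_Mapping.keys_add] *[OF Un_upper1] *[OF Un_upper2]
    by (simp add: lookup_add sum.distrib)
qed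

lemma total_degree_single_one [simp]: "total_degree (Poly_Mapping.single x (Suc 0)) = 1"
  by (simp add: total_degree_def)

lemma total_degree_oneD:
  assumes "total_degree m = 1"
  obtains x where "m = Poly_Mapping.single x 1"
proof -
  obtain x where x: "x \<in> Poly_Mapping.keys m"
    and eq: "Poly_Mapping.lookup m x = 1" 
      "\<And>y. y \<in> Poly_Mapping.keys m \<Longrightarrow> y \<noteq> x \<Longrightarrow> Poly_Mapping.lookup m y = 0"
    using assms sum_eq_1_iff[of "Poly_Mapping.keys m" "Poly_Mapping.lookup m"]
    by (auto simp: total_degree_def)
  have "m = Poly_Mapping.single x 1"
    by (rule poly_mapping_eqI)
      (metis One_nat_def eq lookup_single_eq lookup_single_not_eq not_in_keys_iff_lookup_eq_zero)
  then show ?thesis ..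
qed

text \<open>Degrees add up in products, so multiplication never lowers them. With
  \<open>d = 2\<close> this shows that generators of degree at least two yield no non-zero linear
  form.\<close>

lemma ideal_degree_ge:
  "ideal {p \<in> carrier (poly_ring X). \<forall>m\<in>Poly_Mapping.keys p. d \<le> total_degree m}
    (poly_ring X :: ('x, 'k::field) polynomial ring)"
proof (rule ideal_poly_ringI, goal_cases)
  case (3 p q)
  then show ?case
    using Poly_Mapping.keys_add[of p q] poly_ring_closed by blast
next
  case (4 p q)
  have "d \<le> total_degree m" if "m \<in> Poly_Mapping.keys (p * q)" for m
    using that 4 keys_mult[of p q] by (force simp: total_degree_add)
  with 4 show ?case
    using poly_ring_closed by blast
qed (auto simp: zero_in_poly_ring)

section \<open>Cut monomials\<close>

text \<open>An unordered partition is named by one of its parts; for \<open>A\<close> inside the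
  vertex set, \<open>A\<close> and its complement name the same one.\<close>

definition bipartition :: "'v ugraph \<Rightarrow> 'v set \<Rightarrow> 'v set set" where
  "bipartition G A = {A, verts G - A}"

lemma bipartition_in_unordered_partitions:
  "A \<subseteq> verts G \<Longrightarrow> bipartition G A \<in> unordered_partitions (verts G)"
  unfolding bipartition_def unordered_partitions_def by blast

lemma unordered_partitionsE:
  assumes "P \<in> unordered_partitions (verts G)"
  obtains A where "A \<subseteq> verts G" "P = bipartition G A"
proof -
  obtain A B where "P = {A, B}" "A \<union> B = verts G" "A \<inter> B = {}"
    using assms unfolding unordered_partitions_def by blast
  then show ?thesis
    by (intro that[of A]) (auto simp: bipartition_def)
qed

lemma finite_edges: "simple_graph G \<Longrightarrow> finite (edges G)"
  by (rule finite_subset[of _ "Pow (verts G)"]) (auto simp: simple_graph_def)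

lemma edgeE:
  assumes "simple_graph G" "e \<in> edges G"
  obtains x y where "e = {x, y}" "x \<noteq> y" "x \<in> verts G" "y \<in> verts G"
proof -
  have "e \<subseteq> verts G" "card e = 2"
    using assms by (auto simp: simple_graph_def)
  then show ?thesis
    using that by (auto simp: card_2_iff)
qed

lemma doubleton_edgeD:
  assumes "simple_graph G" "{x, y} \<in> edges G"
  shows "x \<noteq> y" "x \<in> verts G" "y \<in> verts G"
  using assms by (auto simp: simple_graph_def)

lemma cut_edges_subset: "cut_edges G P \<subseteq> edges G"
  by (auto simp: cut_edges_def)

lemma in_cut_edges_bipartition:
  assumes "simple_graph G" "{x, y} \<in> edges G"
  shows "{x, y} \<in> cut_edges G (bipartition G A) \<longleftrightarrow> (x \<in> A) \<noteq> (y \<in> A)"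
proof -
  have "A \<inter> (verts G - A) = {}" by blast
  then show ?thesis
    unfolding bipartition_def using assms doubleton_edgeD[OF assms]
    by (simp add: cut_edges_partition) (auto simp: doubleton_eq_iff)
qed

lemma cut_edges_bipartition_empty_iff:
  assumes "simple_graph G"
  shows "cut_edges G (bipartition G A) = {} \<longleftrightarrow>
    (\<forall>x y. {x, y} \<in> edges G \<longrightarrow> x \<in> A \<longrightarrow> y \<in> A)"
proof -
  have "cut_edges G (bipartition G A) = {} \<longleftrightarrow>
      (\<forall>e\<in>edges G. e \<notin> cut_edges G (bipartition G A))"
    using cut_edges_subset[of G] by blast
  also have "\<dots> \<longleftrightarrow> (\<forall>x y. {x, y} \<in> edges G \<longrightarrow> x \<in> A \<longrightarrow> y \<in> A)"
  proof (intro iffI ballI allI impI)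
    fix x y
    assume "\<forall>e\<in>edges G. e \<notin> cut_edges G (bipartition G A)" "{x, y} \<in> edges G" "x \<in> A"
    then show "y \<in> A"
      using in_cut_edges_bipartition[OF assms, of x y A] by blast
  next
    fix e
    assume closed: "\<forall>x y. {x, y} \<in> edges G \<longrightarrow> x \<in> A \<longrightarrow> y \<in> A" and e: "e \<in> edges G"
    obtain x y where xy: "e = {x, y}"
      using edgeE[OF assms e] by blast
    \<comment> \<open>Edges are unordered, so closedness under neighbours applies in both directions
      and turns the implication into an equivalence.\<close>
    then have "{x, y} \<in> edges G" "{y, x} \<in> edges G"
      using e by (simp_all add: insert_commute)
    then have "x \<in> A \<longleftrightarrow> y \<in> A"
      using closed by blast
    then show "e \<notin> cut_edges G (bipartition G A)"
      using e xy in_cut_edges_bipartition[OF assms, of x y A] by simp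
  qed
  finally show ?thesis .
qed

text \<open>Written this way, each edge contributes exactly one variable, and images of products of
  variables can be compared edge by edge.\<close>

lemma cut_monomial_prod:
  fixes G :: "'v ugraph"
  assumes "finite (edges G)"
  shows "cut_monomial G P = ((\<Prod>e\<in>edges G.
    var (if e \<in> cut_edges G P then S_var e else T_var e)) :: ('v set st_var, 'k::field) polynomial)"
proof -
  have "((\<Prod>e\<in>edges G. var (if e \<in> cut_edges G P then S_var e else T_var e))
        :: ('v set st_var, 'k) polynomial) =
      (\<Prod>e\<in>edges G - cut_edges G P. var (if e \<in> cut_edges G P then S_var e else T_var e)) *
      (\<Prod>e\<in>cut_edges G P. var (if e \<in> cut_edges G P then S_var e else T_var e))"
    by (rule prod.subset_diff[OF cut_edges_subset assms])
  then show ?thesis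
    by (simp add: cut_monomial_def mult.commute)
qed

definition cut_exponent :: "'v ugraph \<Rightarrow> 'v set set \<Rightarrow> ('v set st_var \<Rightarrow>\<^sub>0 nat)" where
  "cut_exponent G P =
    (\<Sum>e\<in>edges G. Poly_Mapping.single (if e \<in> cut_edges G P then S_var e else T_var e) 1)"

lemma cut_monomial_eq_single:
  assumes "finite (edges G)"
  shows "cut_monomial G P = Poly_Mapping.single (cut_exponent G P) 1"
  unfolding cut_monomial_prod[OF assms] cut_exponent_def var_def by (rule prod_single_one)

lemma lookup_cut_exponent:
  assumes "finite (edges G)" "e \<in> edges G"
  shows "Poly_Mapping.lookup (cut_exponent G P) (S_var e) = of_bool (e \<in> cut_edges G P)"
    "Poly_Mapping.lookup (cut_exponent G P) (T_var e) = of_bool (e \<notin> cut_edges G P)"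
proof -
  have "Poly_Mapping.lookup (cut_exponent G P) (S_var e) =
      (\<Sum>f\<in>edges G. if f = e then of_bool (e \<in> cut_edges G P) else 0)"
    unfolding cut_exponent_def lookup_sum
    by (intro sum.cong) (auto simp: lookup_single when_def)
  then show "Poly_Mapping.lookup (cut_exponent G P) (S_var e) = of_bool (e \<in> cut_edges G P)"
    using assms by simp
  have "Poly_Mapping.lookup (cut_exponent G P) (T_var e) =
      (\<Sum>f\<in>edges G. if f = e then of_bool (e \<notin> cut_edges G P) else 0)"
    unfolding cut_exponent_def lookup_sum
    by (intro sum.cong) (auto simp: lookup_single when_def)
  then show "Poly_Mapping.lookup (cut_exponent G P) (T_var e) = of_bool (e \<notin> cut_edges G P)"
    using assms by simp
qed

lemma cut_exponent_eq_iff: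
  assumes "finite (edges G)"
  shows "cut_exponent G P = cut_exponent G Q \<longleftrightarrow> cut_edges G P = cut_edges G Q"
proof
  assume eq: "cut_exponent G P = cut_exponent G Q"
  have "e \<in> cut_edges G P \<longleftrightarrow> e \<in> cut_edges G Q" if "e \<in> edges G" for e
    using lookup_cut_exponent(1)[OF assms that, of P] lookup_cut_exponent(1)[OF assms that, of Q]
    by (simp add: eq of_bool_eq_iff split: if_splits)
  then show "cut_edges G P = cut_edges G Q"
    using cut_edges_subset[of G P] cut_edges_subset[of G Q] by blast
qed (simp add: cut_exponent_def)

section \<open>Linear forms in the cut ideal\<close>

lemma mem_cut_ideal:
  "p \<in> cut_ideal G \<longleftrightarrow>
    p \<in> carrier (poly_ring (unordered_partitions (verts G))) \<and> cut_map G p = 0"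
  by (simp add: cut_ideal_def a_kernel_def')

lemma ideal_poly_subst_kernel:
  "ideal {p \<in> carrier (poly_ring X). poly_subst f p = (0 :: ('y, 'k::field) polynomial)} (poly_ring X)"
  by (rule ideal_poly_ringI)
    (auto simp: zero_in_poly_ring poly_ring_closed poly_subst_add poly_subst_mult)

text \<open>The coefficients of a linear form in the kernel sum to zero over the partitions with any
  fixed cut. The substituted value is the sum of all coefficients minus the sum over the partitions
  with the cut of \<open>Q\<close>, hence zero. To avoid grouping by cuts, this value is read off
  from the image \<open>cut_map G p\<close>.\<close>

lemma linear_form_in_cut_ideal:
  assumes fin: "finite (edges G)" and lin: "linear_form p" and zero: "cut_map G p = 0"
  shows "poly_subst (\<lambda>P. if cut_edges G P = cut_edges G Q then 0 else 1) p =
    (0 :: ('y, 'k::field) polynomial)"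
proof -
  define f :: "'a set set \<Rightarrow> ('y, 'k) polynomial"
    where "f P = (if cut_edges G P = cut_edges G Q then 0 else 1)" for P
  \<comment> \<open>\<open>L\<close> adds up all coefficients and subtracts the one at the cut
    monomial of \<open>Q\<close>. It is additive, and its composite with \<open>cut_map G\<close>
    agrees with the substitution \<open>f\<close> on scalar multiples of single variables, which is
    all that a linear form contains.\<close>
  define L :: "('a set st_var, 'k) polynomial \<Rightarrow> ('y, 'k) polynomial"
    where "L q = poly_subst (\<lambda>_. 1) q - const (Poly_Mapping.lookup q (cut_exponent G Q))" for q
  have L_sum: "L (\<Sum>m\<in>A. g m) = (\<Sum>m\<in>A. L (g m))" for A :: "('a set set \<Rightarrow>\<^sub>0 nat) set" and g
    by (induction A rule: infinite_finite_induct)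
      (simp_all add: L_def poly_subst_add lookup_add const_def single_add)
  have L_single: "L (Poly_Mapping.single (monomial_exponent (cut_exponent G) m) c) =
      poly_subst f (Poly_Mapping.single m c)" if "m \<in> Poly_Mapping.keys p" for m c
  proof -
    have "total_degree m = 1"
      using lin that by (simp add: linear_form_def homogeneous_def)
    then obtain P where P: "m = Poly_Mapping.single P 1"
      by (rule total_degree_oneD)
    show ?thesis
      unfolding P monomial_exponent_single_one
      by (simp add: L_def f_def poly_subst_single lookup_single when_def
          cut_exponent_eq_iff[OF fin] const_def)
  qed
  have "cut_map G p = (\<Sum>m\<in>Poly_Mapping.keys p.
      Poly_Mapping.single (monomial_exponent (cut_exponent G) m) (Poly_Mapping.lookup p m))"
    unfolding cut_map_def
    by (rule poly_subst_monomial_sum) (rule cut_monomial_eq_single[OF fin])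
  then have "L (cut_map G p) =
      (\<Sum>m\<in>Poly_Mapping.keys p. poly_subst f (Poly_Mapping.single m (Poly_Mapping.lookup p m)))"
    by (simp add: L_sum L_single)
  also have "\<dots> = poly_subst f p"
    by (simp flip: poly_subst_sum polynomial_sum_single)
  finally show ?thesis
    by (simp add: zero L_def const_def f_def[abs_def])
qed

text \<open>The kernel of a substitution is an ideal, so what holds for the linear generators passes
  to everything they generate, including the elements of higher degree.\<close>

lemma cut_ideal_vanishing:
  assumes fin: "finite (edges G)"
    and lin: "generated_by_linear_forms (unordered_partitions (verts G))
      (cut_ideal G :: ('v set set, 'k::field) polynomial set)"
    and p: "p \<in> cut_ideal G"
  shows "poly_subst (\<lambda>P. if cut_edges G P = cut_edges G Q then 0 else 1) p =
    (0 :: ('y, 'k) polynomial)"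
proof -
  let ?R = "poly_ring (unordered_partitions (verts G)) :: ('v set set, 'k) polynomial ring"
  interpret cring ?R by (rule cring_poly_ring)
  obtain F where F: "F \<subseteq> carrier ?R" "\<forall>f\<in>F. linear_form f" "cut_ideal G = Idl\<^bsub>?R\<^esub> F"
    using lin unfolding generated_by_linear_forms_def by blast
  have "F \<subseteq> cut_ideal G"
    using genideal_self[OF F(1)] F(3) by simp
  then have "Idl\<^bsub>?R\<^esub> F \<subseteq> {p \<in> carrier ?R.
      poly_subst (\<lambda>P. if cut_edges G P = cut_edges G Q then 0 else 1) p = (0 :: ('y, 'k) polynomial)}"
    using F(2)
    by (intro genideal_minimal ideal_poly_subst_kernel)
      (auto simp: mem_cut_ideal intro!: linear_form_in_cut_ideal[OF fin])
  then show ?thesis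
    using p F(3) by blast
qed

section \<open>A criterion against linear generators\<close>

lemma prod_list_prod_commute:
  fixes g :: "'e \<Rightarrow> 'a \<Rightarrow> 'c::comm_monoid_mult"
  shows "(\<Prod>a\<leftarrow>as. \<Prod>e\<in>E. g e a) = (\<Prod>e\<in>E. \<Prod>a\<leftarrow>as. g e a)"
  by (induction as) (simp_all add: prod.distrib)

lemma prod_list_eq_0: "0 \<in> set xs \<Longrightarrow> prod_list xs = (0 :: 'a::semiring_1)"
  by (induction xs) auto

lemma prod_list_eq_1: "(\<And>x. x \<in> set xs \<Longrightarrow> x = 1) \<Longrightarrow> prod_list xs = (1 :: 'a::monoid_mult)"
  by (induction xs) auto

lemma poly_subst_prod_list:
  fixes f :: "'x \<Rightarrow> ('y, 'k::field) polynomial"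
  shows "poly_subst f (\<Prod>a\<leftarrow>as. var (q a)) = (\<Prod>a\<leftarrow>as. f (q a))"
proof (induction as)
  case Nil
  show ?case using poly_subst_const[of f 1] by (simp add: const_def)
qed (simp add: poly_subst_mult)

lemma prod_list_in_poly_ring:
  assumes "\<And>a. a \<in> set as \<Longrightarrow> q a \<in> X"
  shows "(\<Prod>a\<leftarrow>as. var (q a)) \<in> carrier (poly_ring X)"
  using assms by (induction as) (auto intro: one_in_poly_ring poly_ring_closed var_in_poly_ring)

text \<open>The two lists stand for two monomials in the variables of partitions. That each edge is
  cut equally often on both sides is phrased as an identity of products in arbitrary
  \<open>s\<close> and \<open>t\<close>: it can be checked by cases, and at
  \<open>s = var (S_var e)\<close>, \<open>t = var (T_var e)\<close> it is the contribution of the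
  edge \<open>e\<close> to both images.\<close>

lemma not_generated_by_linear_forms:
  assumes G: "simple_graph G"
    and sub: "\<And>A. A \<in> set As \<union> set Bs \<Longrightarrow> A \<subseteq> verts G"
    and balanced: "\<And>x y s t. {x, y} \<in> edges G \<Longrightarrow>
      (\<Prod>A\<leftarrow>As. if (x \<in> A) \<noteq> (y \<in> A) then s else t) =
      (\<Prod>A\<leftarrow>Bs. if (x \<in> A) \<noteq> (y \<in> A) then s else (t :: ('v set st_var, 'k::field) polynomial))"
    and empty: "{} \<in> set As"
    and nonempty: "\<And>A. A \<in> set Bs \<Longrightarrow> cut_edges G (bipartition G A) \<noteq> {}"
  shows "\<not> generated_by_linear_forms (unordered_partitions (verts G))
    (cut_ideal G :: ('v set set, 'k) polynomial set)"
proof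
  assume lin: "generated_by_linear_forms (unordered_partitions (verts G))
    (cut_ideal G :: ('v set set, 'k) polynomial set)"
  define q where "q As = (\<Prod>A\<leftarrow>As. var (bipartition G A) :: ('v set set, 'k) polynomial)" for As
  have fin: "finite (edges G)"
    using G by (rule finite_edges)
  have cut_q: "cut_map G (q Cs) = (\<Prod>e\<in>edges G. \<Prod>A\<leftarrow>Cs.
      var (if e \<in> cut_edges G (bipartition G A) then S_var e else T_var e))" for Cs
    unfolding q_def cut_map_def poly_subst_prod_list cut_monomial_prod[OF fin]
    by (rule prod_list_prod_commute)
  have "cut_map G (q As) = cut_map G (q Bs)"
    unfolding cut_q
  proof (rule prod.cong)
    fix e assume e: "e \<in> edges G"
    then obtain x y where xy: "e = {x, y}"
      using G edgeE by metis
    show "(\<Prod>A\<leftarrow>As. var (if e \<in> cut_edges G (bipartition G A) then S_var e else T_var e)) =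
      (\<Prod>A\<leftarrow>Bs. (var (if e \<in> cut_edges G (bipartition G A) then S_var e else T_var e)
        :: ('v set st_var, 'k) polynomial))"
      using balanced[of x y "var (S_var e)" "var (T_var e)"] e
      unfolding xy if_distrib[of var] by (simp add: in_cut_edges_bipartition[OF G])
  qed simp
  moreover have "q As \<in> carrier (poly_ring (unordered_partitions (verts G)))"
    "q Bs \<in> carrier (poly_ring (unordered_partitions (verts G)))"
    unfolding q_def using sub
    by (auto intro!: prod_list_in_poly_ring bipartition_in_unordered_partitions)
  ultimately have mem: "q As - q Bs \<in> cut_ideal G"
    by (simp add: mem_cut_ideal poly_ring_closed) (simp add: cut_map_def poly_subst_diff)
  have "cut_edges G (bipartition G {}) = {}"
    by (simp add: cut_edges_bipartition_empty_iff[OF G])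
  \<comment> \<open>Taking the empty cut as reference, \<open>f\<close> kills the factor of
    \<open>{}\<close> in \<open>q As\<close> and sends every factor of \<open>q Bs\<close> to
    \<open>1\<close>, so the binomial \<open>q As - q Bs\<close> goes to \<open>-1\<close> although
    it lies in the ideal.\<close>
  define f :: "'v set set \<Rightarrow> ('v, 'k) polynomial"
    where "f P = (if cut_edges G P = cut_edges G (bipartition G {}) then 0 else 1)" for P
  have "poly_subst f (q As) = 0"
    unfolding q_def poly_subst_prod_list
    by (rule prod_list_eq_0) (use empty in \<open>auto simp: f_def intro!: image_eqI[of _ _ "{}"]\<close>)
  moreover have "poly_subst f (q Bs) = 1"
    unfolding q_def poly_subst_prod_list
    by (rule prod_list_eq_1) (use nonempty \<open>cut_edges G (bipartition G {}) = {}\<close> in \<open>auto simp: f_def\<close>)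
  ultimately show False
    using cut_ideal_vanishing[OF fin lin mem, of "bipartition G {}", where ?'y = 'v]
    by (simp add: poly_subst_diff f_def[abs_def])
qed

section \<open>Graphs whose cut ideal is generated by linear forms\<close>

text \<open>No edge joins \<open>u\<close> and \<open>v\<close>, so an edge meeting
  \<open>{u, v}\<close> has exactly one end there. It is cut once by \<open>{u, v}\<close>, and once
  by exactly one of \<open>{u}\<close> and \<open>{v}\<close>. The edges to \<open>u'\<close> and
  \<open>v'\<close> make the cuts of both singletons non-empty.\<close>

lemma not_linear_if_nonadjacent:
  assumes G: "simple_graph G"
    and uv: "u \<noteq> v" "{u, v} \<notin> edges G" "{u, u'} \<in> edges G" "{v, v'} \<in> edges G"
  shows "\<not> generated_by_linear_forms (unordered_partitions (verts G))
    (cut_ideal G :: ('v set set, 'k::field) polynomial set)"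
proof (rule not_generated_by_linear_forms[OF G, where As = "[{}, {u, v}]" and Bs = "[{u}, {v}]"])
  fix x y and s t :: "('v set st_var, 'k) polynomial"
  assume "{x, y} \<in> edges G"
  then have "x \<noteq> y" "{x, y} \<noteq> {u, v}"
    using doubleton_edgeD[OF G] uv(2) by auto
  then show "(\<Prod>A\<leftarrow>[{}, {u, v}]. if (x \<in> A) \<noteq> (y \<in> A) then s else t) =
      (\<Prod>A\<leftarrow>[{u}, {v}]. if (x \<in> A) \<noteq> (y \<in> A) then s else t)"
    using uv(1)
    by (cases "x = u"; cases "x = v"; cases "y = u"; cases "y = v") (simp_all add: mult_ac insert_commute)
next
  fix A assume "A \<in> set [{u}, {v}]"
  then show "cut_edges G (bipartition G A) \<noteq> {}"
    using uv(3,4) doubleton_edgeD[OF G uv(3)] doubleton_edgeD[OF G uv(4)]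
    by (auto simp: cut_edges_bipartition_empty_iff[OF G])
qed (use doubleton_edgeD[OF G uv(3)] doubleton_edgeD[OF G uv(4)] in auto)

text \<open>Whether an edge is cut by \<open>A\<close> is a quadratic function of the indicator of \<open>A\<close>, so
  its third difference in the directions of \<open>a\<close>, \<open>b\<close> and \<open>c\<close> vanishes.\<close>

lemma not_linear_if_three_vertices:
  assumes G: "simple_graph G"
    and abc: "a \<noteq> b" "a \<noteq> c" "b \<noteq> c"
      "{a, a'} \<in> edges G" "{b, b'} \<in> edges G" "{c, c'} \<in> edges G" "a' \<notin> {a, b, c}"
  shows "\<not> generated_by_linear_forms (unordered_partitions (verts G))
    (cut_ideal G :: ('v set set, 'k::field) polynomial set)"
proof (rule not_generated_by_linear_forms[OF G, where As = "[{}, {a, b}, {a, c}, {b, c}]"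
      and Bs = "[{a}, {b}, {c}, {a, b, c}]"])
  fix x y and s t :: "('v set st_var, 'k) polynomial"
  assume "{x, y} \<in> edges G"
  then have "x \<noteq> y"
    using doubleton_edgeD[OF G] by auto
  then show "(\<Prod>A\<leftarrow>[{}, {a, b}, {a, c}, {b, c}]. if (x \<in> A) \<noteq> (y \<in> A) then s else t) =
      (\<Prod>A\<leftarrow>[{a}, {b}, {c}, {a, b, c}]. if (x \<in> A) \<noteq> (y \<in> A) then s else t)"
    using abc(1-3)
    by (cases "x = a"; cases "x = b"; cases "x = c"; cases "y = a"; cases "y = b"; cases "y = c")
      (simp_all add: mult_ac)
next
  \<comment> \<open>The three given edges are cut by the respective singletons; the first one also
    leaves \<open>{a, b, c}\<close> because \<open>a'\<close> lies outside.\<close>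
  fix A assume "A \<in> set [{a}, {b}, {c}, {a, b, c}]"
  then show "cut_edges G (bipartition G A) \<noteq> {}"
    using abc(4-7) doubleton_edgeD[OF G abc(4)] doubleton_edgeD[OF G abc(5)]
      doubleton_edgeD[OF G abc(6)]
    by (auto simp: cut_edges_bipartition_empty_iff[OF G])
qed (use doubleton_edgeD[OF G abc(4)] doubleton_edgeD[OF G abc(5)]
      doubleton_edgeD[OF G abc(6)] in auto)

lemma linear_imp_complete_on_support:
  assumes G: "simple_graph G" and "edges G \<noteq> {}"
    and lin: "generated_by_linear_forms (unordered_partitions (verts G))
      (cut_ideal G :: ('v set set, 'k::field) polynomial set)"
  shows "\<exists>N\<subseteq>verts G. card N \<in> {2, 3} \<and> edges G = {e. e \<subseteq> N \<and> card e = 2}"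
proof -
  \<comment> \<open>\<open>N\<close> is the set of non-isolated vertices.\<close>
  define N where "N = \<Union>(edges G)"
  have N: "N \<subseteq> verts G" "finite N"
    using G finite_subset[of N "verts G"] by (auto simp: N_def simple_graph_def)
  have nbr: "\<exists>y. {x, y} \<in> edges G" if "x \<in> N" for x
    using that by (auto simp: N_def) (metis G edgeE insertE insert_commute singletonD)
  have edges: "edges G = {e. e \<subseteq> N \<and> card e = 2}"
  proof
    show "edges G \<subseteq> {e. e \<subseteq> N \<and> card e = 2}"
      using G by (auto simp: N_def simple_graph_def)
    show "{e. e \<subseteq> N \<and> card e = 2} \<subseteq> edges G"
    proof
      fix e assume "e \<in> {e. e \<subseteq> N \<and> card e = 2}"
      then obtain u v where e: "e = {u, v}" "u \<noteq> v" "u \<in> N" "v \<in> N"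
        by (auto simp: card_2_iff)
      then show "e \<in> edges G"
        using not_linear_if_nonadjacent[OF G, of u v] lin nbr by blast
    qed
  qed
  obtain u v where uv: "{u, v} \<in> edges G" "u \<noteq> v"
    using \<open>edges G \<noteq> {}\<close> G edgeE by (metis ex_in_conv)
  then have uvN: "{u, v} \<subseteq> N"
    by (auto simp: N_def)
  have "card N \<le> 3"
  proof (rule ccontr)
    assume "\<not> card N \<le> 3"
    \<comment> \<open>Two further non-isolated vertices \<open>w\<close> and \<open>x\<close> exist
      besides the ends of the edge \<open>{u, v}\<close>. The triple \<open>u\<close>,
      \<open>w\<close>, \<open>x\<close> then has the edge \<open>{u, v}\<close> leaving it.\<close>
    then have "2 \<le> card (N - {u, v})"
      using uvN uv(2) by (simp add: card_Diff_subset)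
    then obtain W where "W \<subseteq> N - {u, v}" "card W = 2"
      by (metis obtain_subset_with_card_n)
    then obtain w x where "w \<in> N - {u, v}" "x \<in> N - {u, v}" "w \<noteq> x"
      by (auto simp: card_2_iff)
    moreover from this nbr obtain w' x' where "{w, w'} \<in> edges G" "{x, x'} \<in> edges G"
      by blast
    ultimately show False
      using not_linear_if_three_vertices[OF G, of u w x v w' x'] uv lin by blast
  qed
  moreover have "2 \<le> card N"
    using card_mono[OF N(2) uvN] uv(2) by simp
  ultimately have "card N \<in> {2, 3}"
    by auto
  with N(1) edges show ?thesis by blast
qed

section \<open>Disconnected graphs and the degree of generators\<close>

text \<open>The component \<open>C\<close> of \<open>u\<close> contains \<open>u\<close> but misses
  \<open>v\<close>, so it differs from both the empty set and the vertex set. No edge leaves it,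
  hence its cut is empty, like that of \<open>{}\<close>.\<close>

lemma disconnected_linear_binomial:
  assumes G: "simple_graph G" and "\<not> connected_graph G"
  obtains P Q where "P \<in> unordered_partitions (verts G)" "Q \<in> unordered_partitions (verts G)"
    "P \<noteq> Q" "cut_edges G P = cut_edges G Q"
proof -
  let ?R = "{(x, y). {x, y} \<in> edges G}\<^sup>*"
  obtain u v where uv: "u \<in> verts G" "v \<in> verts G" "(u, v) \<notin> ?R"
    using assms(2) unfolding connected_graph_def by blast
  define C where "C = {w \<in> verts G. (u, w) \<in> ?R}"
  have "cut_edges G (bipartition G C) = {}"
    unfolding cut_edges_bipartition_empty_iff[OF G]
    using doubleton_edgeD[OF G] by (auto simp: C_def intro: rtrancl_into_rtrancl)
  moreover have "cut_edges G (bipartition G {}) = {}"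
    by (simp add: cut_edges_bipartition_empty_iff[OF G])
  moreover have "bipartition G C \<noteq> bipartition G {}"
    using uv by (auto simp: bipartition_def doubleton_eq_iff C_def)
  moreover have "C \<subseteq> verts G" by (auto simp: C_def)
  ultimately show ?thesis
    using that[of "bipartition G C" "bipartition G {}"] by (simp add: bipartition_in_unordered_partitions)
qed

lemma var_diff_in_cut_ideal:
  assumes "P \<in> unordered_partitions (verts G)" "Q \<in> unordered_partitions (verts G)"
    "cut_edges G P = cut_edges G Q"
  shows "var P - var Q \<in> (cut_ideal G :: ('v set set, 'k::field) polynomial set)"
  using assms by (simp add: mem_cut_ideal poly_ring_closed var_in_poly_ring)
    (simp add: cut_map_def poly_subst_diff cut_monomial_def)

lemma linear_form_var_diff:
  "linear_form (var P - var Q :: ('x, 'k::field) polynomial)"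
proof -
  have "m = Poly_Mapping.single P 1 \<or> m = Poly_Mapping.single Q 1"
    if "m \<in> Poly_Mapping.keys (var P - var Q :: ('x, 'k) polynomial)" for m
    using that keys_diff[of "var P :: ('x, 'k) polynomial" "var Q"] by (auto simp: var_def)
  then show ?thesis
    by (force simp: linear_form_def homogeneous_def)
qed

text \<open>The ideal contains a non-zero linear form, which rules out generators of degree at least
  two. Generators of degree zero would be constants, and \<open>cut_map G\<close> fixes constants,
  so all of them would vanish and with them the ideal.\<close>

lemma single_degree_imp_linear:
  assumes "simple_graph G" "\<not> connected_graph G"
    and gen: "generated_in_single_degree (unordered_partitions (verts G))
      (cut_ideal G :: ('v set set, 'k::field) polynomial set)"
  shows "generated_by_linear_forms (unordered_partitions (verts G))
      (cut_ideal G :: ('v set set, 'k) polynomial set)"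
proof -
  let ?R = "poly_ring (unordered_partitions (verts G)) :: ('v set set, 'k) polynomial ring"
  interpret cring ?R by (rule cring_poly_ring)
  obtain d F where F: "F \<subseteq> carrier ?R" "\<forall>f\<in>F. homogeneous d f"
      "(cut_ideal G :: ('v set set, 'k) polynomial set) = Idl\<^bsub>?R\<^esub> F"
    using gen unfolding generated_in_single_degree_def by blast
  obtain P Q where PQ: "P \<in> unordered_partitions (verts G)" "Q \<in> unordered_partitions (verts G)"
    "P \<noteq> Q" "cut_edges G P = cut_edges G Q"
    using disconnected_linear_binomial[OF assms(1,2)] .
  let ?p = "var P - var Q :: ('v set set, 'k) polynomial"
  have p: "?p \<in> Idl\<^bsub>?R\<^esub> F"
    using var_diff_in_cut_ideal[OF PQ(1,2,4)] F(3) by blast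
  \<comment> \<open>As \<open>P\<close> and \<open>Q\<close> differ, their terms cannot
    cancel.\<close>
  have lookup_p: "Poly_Mapping.lookup ?p (Poly_Mapping.single P 1) = 1"
  proof -
    have "Poly_Mapping.single Q 1 \<noteq> (Poly_Mapping.single P 1 :: 'v set set \<Rightarrow>\<^sub>0 nat)"
      by (metis PQ(3) lookup_single_eq lookup_single_not_eq zero_neq_one)
    then show ?thesis
      by (simp add: var_def lookup_minus lookup_single when_def)
  qed
  then have key: "Poly_Mapping.single P 1 \<in> Poly_Mapping.keys ?p"
    by (simp add: in_keys_iff del: lookup_not_eq_zero_eq_in_keys)
  have "\<not> d \<ge> 2"
  proof
    assume "d \<ge> 2"
    then have "Idl\<^bsub>?R\<^esub> F \<subseteq> {p \<in> carrier ?R. \<forall>m\<in>Poly_Mapping.keys p. 2 \<le> total_degree m}"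
      using F(1,2) by (intro genideal_minimal ideal_degree_ge) (auto simp: homogeneous_def)
    then have "2 \<le> total_degree (Poly_Mapping.single P 1)"
      using p key by blast
    then show False by simp
  qed
  moreover have "d \<noteq> 0"
  proof
    assume "d = 0"
    have "f = 0" if "f \<in> F" for f
    proof -
      have "m = 0" if "m \<in> Poly_Mapping.keys f" for m
        using F(2) \<open>f \<in> F\<close> \<open>d = 0\<close> that
        by (auto simp: homogeneous_def total_degree_def intro!: poly_mapping_eqI)
           (metis in_keys_iff neq0_conv)
      then have f: "f = const (Poly_Mapping.lookup f 0)"
        by (intro poly_mapping_eqI)
          (metis const_def lookup_single_eq lookup_single_not_eq not_in_keys_iff_lookup_eq_zero)
      have "cut_map G f = 0"
        using genideal_self[OF F(1)] F(3) \<open>f \<in> F\<close> mem_cut_ideal by blast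
      then have "(const (Poly_Mapping.lookup f 0) :: ('v set st_var, 'k) polynomial) = 0"
        using arg_cong[OF f, of "cut_map G"] by (simp add: cut_map_def)
      then have "Poly_Mapping.lookup f 0 = 0"
        by (metis const_def lookup_single_eq lookup_zero)
      then show "f = 0"
        using f by (simp add: const_def)
    qed
    then have "Idl\<^bsub>?R\<^esub> F \<subseteq> {\<zero>\<^bsub>?R\<^esub>}"
      by (intro genideal_minimal zeroideal) auto
    then have "?p = 0" using p by auto
    then show False using lookup_p by simp
  qed
  ultimately have "d = 1" by simp
  then show ?thesis
    using F unfolding generated_by_linear_forms_def linear_form_def by blast
qed

section \<open>Sufficiency: cuts at equal distance\<close>

text \<open>For each edge, the sum takes the exponent of the variable that does not occur in the cut
  monomial of \<open>P\<close>. A factor \<open>Q\<close> of \<open>m\<close> contributes the number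
  of edges on which its cut differs from that of \<open>P\<close>: zero for \<open>Q = P\<close>,
  and \<open>s\<close> otherwise. The term for \<open>P\<close> is added on the left instead of
  being subtracted in the natural numbers.\<close>

lemma sum_disagreement:
  assumes fin: "finite (edges G)"
    and equidistant: "\<And>Q. Q \<in> Poly_Mapping.keys m \<Longrightarrow> Q \<noteq> P \<Longrightarrow>
      card (sym_diff (cut_edges G P) (cut_edges G Q)) = s"
  shows "(\<Sum>e\<in>edges G. Poly_Mapping.lookup (monomial_exponent (cut_exponent G) m)
      (if e \<in> cut_edges G P then T_var e else S_var e)) + s * Poly_Mapping.lookup m P =
    s * total_degree m"
proof -
  let ?K = "Poly_Mapping.keys m"
  have dis: "(\<Sum>e\<in>edges G. Poly_Mapping.lookup (cut_exponent G Q)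
      (if e \<in> cut_edges G P then T_var e else S_var e)) =
      card (sym_diff (cut_edges G P) (cut_edges G Q))" for Q
  proof -
    have "(\<Sum>e\<in>edges G. Poly_Mapping.lookup (cut_exponent G Q)
        (if e \<in> cut_edges G P then T_var e else S_var e)) =
        (\<Sum>e\<in>edges G. of_bool (e \<in> sym_diff (cut_edges G P) (cut_edges G Q)))"
      by (intro sum.cong) (auto simp: lookup_cut_exponent[OF fin])
    also have "\<dots> = card (edges G \<inter> sym_diff (cut_edges G P) (cut_edges G Q))"
      unfolding of_bool_def sum.If_cases[OF fin] Collect_mem_eq by simp
    also have "edges G \<inter> sym_diff (cut_edges G P) (cut_edges G Q) =
        sym_diff (cut_edges G P) (cut_edges G Q)"
      using cut_edges_subset[of G P] cut_edges_subset[of G Q] by blast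
    finally show ?thesis .
  qed
  have "(\<Sum>e\<in>edges G. Poly_Mapping.lookup (monomial_exponent (cut_exponent G) m)
      (if e \<in> cut_edges G P then T_var e else S_var e)) =
      (\<Sum>Q\<in>?K. Poly_Mapping.lookup m Q *
        card (sym_diff (cut_edges G P) (cut_edges G Q)))"
    unfolding lookup_monomial_exponent
    by (subst sum.swap) (simp only: sum_distrib_left[symmetric] dis)
  also have "\<dots> = (\<Sum>Q\<in>?K. if Q = P then 0 else s * Poly_Mapping.lookup m Q)"
    using equidistant by (intro sum.cong) (auto simp: mult.commute)
  moreover have "(\<Sum>Q\<in>?K. if Q = P then s * Poly_Mapping.lookup m Q else 0) =
      s * Poly_Mapping.lookup m P"
    by (simp add: not_in_keys_iff_lookup_eq_zero)
  moreover have "(\<Sum>Q\<in>?K. if Q = P then 0 else s * Poly_Mapping.lookup m Q) +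
      (\<Sum>Q\<in>?K. if Q = P then s * Poly_Mapping.lookup m Q else 0) = s * total_degree m"
    unfolding total_degree_def sum_distrib_left sum.distrib[symmetric]
    by (intro sum.cong) auto
  ultimately show ?thesis by simp
qed

text \<open>The degree of a monomial is the sum of the exponents of \<open>s\<^sub>e\<close> and \<open>t\<^sub>e\<close> in its image, for any
  edge \<open>e\<close>; the previous lemma then yields every single exponent.\<close>

lemma cut_monomials_independent:
  assumes fin: "finite (edges G)" and "edges G \<noteq> {}" and "s > 0"
    and equidistant: "\<And>P Q. P \<in> Y \<Longrightarrow> Q \<in> Y \<Longrightarrow> P \<noteq> Q \<Longrightarrow>
      card (sym_diff (cut_edges G P) (cut_edges G Q)) = s"
  shows "inj_on (monomial_exponent (cut_exponent G)) {m. Poly_Mapping.keys m \<subseteq> Y}"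
proof (rule inj_onI)
  fix m n
  assume mn: "m \<in> {m. Poly_Mapping.keys m \<subseteq> Y}" "n \<in> {m. Poly_Mapping.keys m \<subseteq> Y}"
    and eq: "monomial_exponent (cut_exponent G) m = monomial_exponent (cut_exponent G) n"
  obtain e where e: "e \<in> edges G"
    using \<open>edges G \<noteq> {}\<close> by blast
  \<comment> \<open>Every cut monomial contains exactly one of the two variables of the edge
    \<open>e\<close>, with exponent one.\<close>
  have degree: "total_degree k =
      Poly_Mapping.lookup (monomial_exponent (cut_exponent G) k) (S_var e) +
      Poly_Mapping.lookup (monomial_exponent (cut_exponent G) k) (T_var e)" for k
    unfolding lookup_monomial_exponent total_degree_def sum.distrib[symmetric]
    by (intro sum.cong) (auto simp: lookup_cut_exponent[OF fin e])
  have sum: "(\<Sum>e\<in>edges G. Poly_Mapping.lookup (monomial_exponent (cut_exponent G) k)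
      (if e \<in> cut_edges G P then T_var e else S_var e)) + s * Poly_Mapping.lookup k P =
      s * total_degree k" if "Poly_Mapping.keys k \<subseteq> Y" "P \<in> Y" for k P
    by (rule sum_disagreement[OF fin]) (use equidistant that in blast)
  show "m = n"
  proof (rule poly_mapping_eqI)
    fix P
    show "Poly_Mapping.lookup m P = Poly_Mapping.lookup n P"
    proof (cases "P \<in> Y")
      case True
      have deg: "total_degree m = total_degree n"
        unfolding degree eq ..
      have "Poly_Mapping.keys m \<subseteq> Y" "Poly_Mapping.keys n \<subseteq> Y"
        using mn by simp_all
      note sum[OF this(1) True, unfolded eq deg] sum[OF this(2) True]
      then have "s * Poly_Mapping.lookup m P = s * Poly_Mapping.lookup n P"
        by linarith
      then show ?thesis
        using \<open>s > 0\<close> by simp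
    next
      case False
      then have "P \<notin> Poly_Mapping.keys m" "P \<notin> Poly_Mapping.keys n"
        using mn by auto
      then show ?thesis
        by (simp add: not_in_keys_iff_lookup_eq_zero)
    qed
  qed
qed

text \<open>Congruence modulo \<open>J\<close> respects sums and products, so it spreads from the
  variables to all polynomials by induction.\<close>

lemma poly_subst_congruent_mod_ideal:
  assumes J: "ideal J (poly_ring X :: ('x, 'k::field) polynomial ring)"
    and r: "r ` X \<subseteq> X" "\<And>x. x \<in> X \<Longrightarrow> var x - var (r x) \<in> J"
    and p: "p \<in> carrier (poly_ring X)"
  shows "p - poly_subst (\<lambda>x. var (r x)) p \<in> J"
proof -
  interpret J: ideal J "poly_ring X :: ('x, 'k) polynomial ring" by fact
  have closed: "poly_subst (\<lambda>x. var (r x)) q \<in> carrier (poly_ring X)"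
    if "q \<in> carrier (poly_ring X)" for q :: "('x, 'k) polynomial"
    by (rule ring_hom_closed[OF poly_subst_ring_hom that])
      (use r(1) in \<open>auto intro: var_in_poly_ring\<close>)
  show ?thesis
    using p
  proof (induction rule: poly_ring_induct)
    case (const c)
    then show ?case
      using additive_subgroup.zero_closed[OF J.additive_subgroup_axioms] by simp
  next
    case (var x)
    then show ?case
      using r(2) by simp
  next
    case (add p q)
    then show ?case
      using ideal_poly_ringD(1)[OF J add(3,4)] by (simp add: poly_subst_add algebra_simps)
  next
    case (mult p q)
    let ?\<rho> = "poly_subst (\<lambda>x. var (r x))"
    \<comment> \<open>This element equals \<open>p * q\<close> minus its image, the mixed terms
      cancelling.\<close>
    have "q * (p - ?\<rho> p) + ?\<rho> p * (q - ?\<rho> q) \<in> J"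
      by (intro ideal_poly_ringD[OF J] mult closed)
    then show ?case
      by (simp add: poly_subst_mult algebra_simps)
  qed
qed

text \<open>Modulo differences of variables with equal cuts, every element \<open>p\<close> of the
  ideal is congruent to a polynomial \<open>p'\<close> in one chosen variable per cut. It again lies
  in the kernel, but the cut map sends distinct monomials in the chosen variables to distinct
  monomials, so \<open>p' = 0\<close>.\<close>

lemma equidistant_imp_linear:
  fixes G :: "'v ugraph"
  assumes G: "simple_graph G" and "edges G \<noteq> {}" and "s > 0"
    and equidistant: "\<And>A B. cut_edges G (bipartition G A) \<noteq> cut_edges G (bipartition G B) \<Longrightarrow>
      card (sym_diff (cut_edges G (bipartition G A)) (cut_edges G (bipartition G B))) = s"
  shows "generated_by_linear_forms (unordered_partitions (verts G))
      (cut_ideal G :: ('v set set, 'k::field) polynomial set)"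
proof -
  let ?U = "unordered_partitions (verts G)"
  let ?R = "poly_ring ?U :: ('v set set, 'k) polynomial ring"
  interpret cring ?R by (rule cring_poly_ring)
  have fin: "finite (edges G)"
    using G by (rule finite_edges)
  define F where "F = {var P - var Q :: ('v set set, 'k) polynomial | P Q.
    P \<in> ?U \<and> Q \<in> ?U \<and> cut_edges G P = cut_edges G Q}"
  have F: "F \<subseteq> cut_ideal G"
    by (auto simp: F_def intro: var_diff_in_cut_ideal)
  then have F_carrier: "F \<subseteq> carrier ?R"
    by (auto simp: mem_cut_ideal)
  have J: "ideal (Idl\<^bsub>?R\<^esub> F) ?R"
    by (rule genideal_ideal[OF F_carrier])
  have le: "Idl\<^bsub>?R\<^esub> F \<subseteq> cut_ideal G"
    by (rule genideal_minimal[OF ideal_cut_ideal F])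
  \<comment> \<open>The predicate under \<open>SOME\<close> depends on \<open>P\<close> only through
    its cut, so partitions with equal cuts get the same representative.\<close>
  define r where "r P = (SOME Q. Q \<in> ?U \<and> cut_edges G Q = cut_edges G P)" for P
  have r: "r P \<in> ?U" "cut_edges G (r P) = cut_edges G P" if "P \<in> ?U" for P
    using someI[of "\<lambda>Q. Q \<in> ?U \<and> cut_edges G Q = cut_edges G P" P] that by (auto simp: r_def)
  have r_eq: "r P = r Q" if "cut_edges G P = cut_edges G Q" for P Q
    using that by (simp add: r_def)
  have "cut_ideal G \<subseteq> Idl\<^bsub>?R\<^esub> F"
  proof
    fix p :: "('v set set, 'k) polynomial" assume p: "p \<in> cut_ideal G"
    define p' where "p' = poly_subst (\<lambda>P. var (r P)) p"
    have carrier: "p \<in> carrier ?R"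
      using p by (simp add: mem_cut_ideal)
    have diff: "p - p' \<in> Idl\<^bsub>?R\<^esub> F"
      unfolding p'_def
    proof (rule poly_subst_congruent_mod_ideal[OF J _ _ carrier])
      fix P assume "P \<in> ?U"
      then have "var P - var (r P) \<in> F"
        unfolding F_def using r[of P] by blast
      then show "var P - var (r P) \<in> Idl\<^bsub>?R\<^esub> F"
        using genideal_self[OF F_carrier] by blast
    qed (use r in auto)
    then have "cut_map G (p - p') = 0"
      using le by (auto simp: mem_cut_ideal)
    then have zero: "cut_map G p' = 0"
      using p by (simp add: mem_cut_ideal) (simp add: cut_map_def poly_subst_diff)
    have "p' \<in> carrier (poly_ring (r ` ?U))"
      unfolding p'_def
      by (rule ring_hom_closed[OF poly_subst_ring_hom carrier]) (auto intro: var_in_poly_ring)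
    then have keys: "Poly_Mapping.keys p' \<subseteq> {m. Poly_Mapping.keys m \<subseteq> r ` ?U}"
      by (auto simp: poly_ring_def indets_def)
    have "card (sym_diff (cut_edges G P) (cut_edges G Q)) = s"
      if PQ: "P \<in> r ` ?U" "Q \<in> r ` ?U" "P \<noteq> Q" for P Q
    proof -
      have "P \<in> ?U" "Q \<in> ?U"
        using PQ r by auto
      moreover have "cut_edges G P \<noteq> cut_edges G Q"
        using PQ r r_eq by (metis imageE)
      ultimately show ?thesis
        using equidistant by (metis unordered_partitionsE)
    qed
    then have "inj_on (monomial_exponent (cut_exponent G)) {m. Poly_Mapping.keys m \<subseteq> r ` ?U}"
      by (rule cut_monomials_independent[OF fin \<open>edges G \<noteq> {}\<close> \<open>s > 0\<close>])
    then have "inj_on (monomial_exponent (cut_exponent G)) (Poly_Mapping.keys p')"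
      using keys by (rule inj_on_subset)
    moreover have "poly_subst (cut_monomial G) p' = (0 :: ('v set st_var, 'k) polynomial)"
      using zero by (simp only: cut_map_def)
    ultimately have "p' = 0"
      by (rule poly_subst_monomial_inj[of "cut_monomial G" "cut_exponent G",
            OF cut_monomial_eq_single[OF fin]])
    then show "p \<in> Idl\<^bsub>?R\<^esub> F"
      using diff by simp
  qed
  then have "cut_ideal G = Idl\<^bsub>?R\<^esub> F"
    using le by blast
  moreover have "\<forall>f\<in>F. linear_form f"
    using linear_form_var_diff by (auto simp: F_def)
  ultimately show ?thesis
    unfolding generated_by_linear_forms_def using F_carrier by blast
qed

text \<open>On two vertices the possible cuts are the empty one and the single edge, at distance 1.
  On three vertices they are the empty one and the three pairs of edges, any two of which differ in
  exactly 2 edges.\<close>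

lemma complete_on_support_imp_linear:
  fixes G :: "'v ugraph"
  assumes G: "simple_graph G" and "card N \<in> {2, 3}" and edges: "edges G = {e. e \<subseteq> N \<and> card e = 2}"
  shows "generated_by_linear_forms (unordered_partitions (verts G))
      (cut_ideal G :: ('v set set, 'k::field) polynomial set)"
proof -
  consider "card N = 2" | "card N = 3"
    using assms(2) by auto
  then show ?thesis
  proof cases
    case 1
    then obtain a b where ab: "N = {a, b}" "a \<noteq> b"
      by (auto simp: card_2_iff)
    then have E: "edges G = {{a, b}}"
      unfolding edges by (auto simp: card_2_iff)
    have cut: "cut_edges G (bipartition G A) = (if (a \<in> A) \<noteq> (b \<in> A) then {{a, b}} else {})" for A
      using cut_edges_subset[of G "bipartition G A"] in_cut_edges_bipartition[OF G, of a b A]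
      unfolding E by auto
    show ?thesis
      by (rule equidistant_imp_linear[OF G, of 1]) (auto simp: E cut split: if_splits)
  next
    case 2
    then obtain a b c where abc: "N = {a, b, c}" "a \<noteq> b" "a \<noteq> c" "b \<noteq> c"
      by (auto simp: card_3_iff)
    then have E: "edges G = {{a, b}, {a, c}, {b, c}}"
      unfolding edges by (auto simp: card_2_iff)
    have cut: "cut_edges G (bipartition G A) =
        (if (a \<in> A) \<noteq> (b \<in> A) then {{a, b}} else {}) \<union>
        (if (a \<in> A) \<noteq> (c \<in> A) then {{a, c}} else {}) \<union>
        (if (b \<in> A) \<noteq> (c \<in> A) then {{b, c}} else {})" (is "_ = ?C") for A
    proof -
      have "e \<in> cut_edges G (bipartition G A) \<longleftrightarrow> e \<in> ?C" if "e \<in> edges G" for e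
      proof -
        have "{a, b} \<noteq> {a, c}" "{a, b} \<noteq> {b, c}" "{a, c} \<noteq> {b, c}"
          using abc by (auto simp: doubleton_eq_iff)
        then show ?thesis
          using that in_cut_edges_bipartition[OF G, of a b A] in_cut_edges_bipartition[OF G, of a c A]
            in_cut_edges_bipartition[OF G, of b c A]
          unfolding E by (elim insertE emptyE) simp_all
      qed
      moreover have "?C \<subseteq> edges G"
        unfolding E by auto
      ultimately show ?thesis
        using cut_edges_subset[of G "bipartition G A"] by blast
    qed
    have ne: "{a, b} \<noteq> {a, c}" "{a, b} \<noteq> {b, c}" "{a, c} \<noteq> {b, c}"
      using abc by (auto simp: doubleton_eq_iff)
    show ?thesis
    proof (rule equidistant_imp_linear[OF G, of 2])
      fix A B
      assume "cut_edges G (bipartition G A) \<noteq> cut_edges G (bipartition G B)"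
      then show "card (sym_diff (cut_edges G (bipartition G A)) (cut_edges G (bipartition G B))) = 2"
        unfolding cut using ne ne[symmetric]
        by (cases "a \<in> A"; cases "b \<in> A"; cases "c \<in> A"; cases "a \<in> B"; cases "b \<in> B"; cases "c \<in> B")
          (simp_all add: insert_Diff_if)
    qed (auto simp: E)
  qed
qed

section \<open>Complete graphs with isolated vertices\<close>

lemma edges_complete_graph:
  "edges (complete_graph n) = {{i, j} | i j. i < n \<and> j < n \<and> i \<noteq> j}"
proof (rule Set.set_eqI)
  fix e
  have "e \<in> edges (complete_graph n) \<longleftrightarrow> (\<exists>i j. e = {i, j} \<and> i \<noteq> j \<and> e \<subseteq> {..<n})"
    by (simp add: complete_graph_def card_2_iff) blast
  also have "\<dots> \<longleftrightarrow> (\<exists>i j. e = {i, j} \<and> i \<noteq> j \<and> i < n \<and> j < n)"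
    by (intro ex_cong1 conj_cong refl) simp
  finally show "e \<in> edges (complete_graph n) \<longleftrightarrow>
      e \<in> {{i, j} | i j. i < n \<and> j < n \<and> i \<noteq> j}"
    by (simp only: mem_Collect_eq) metis
qed

lemma edges_disjoint_sum_isolated:
  "edges (disjoint_sum H (disjoint_family_sum {1..t::nat} (\<lambda>_. complete_graph 1))) =
    (`) Inl ` edges H"
proof -
  have "edges (complete_graph 1) = {}"
    by (auto simp: complete_graph_def lessThan_Suc subset_singleton_iff card_2_iff doubleton_eq_iff)
  then show ?thesis
    by (simp add: disjoint_sum_def disjoint_family_sum_def)
qed

lemma verts_disjoint_sum_isolated:
  "verts (disjoint_sum H (disjoint_family_sum {1..t::nat} (\<lambda>_. complete_graph 1))) =
    Inl ` verts H \<union> Inr ` ({1..t} \<times> {0})"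
  by (auto simp: disjoint_sum_def disjoint_family_sum_def complete_graph_def Plus_def)

text \<open>This replaces the isomorphism to a disjoint sum by a vertex subset inside
  \<open>G\<close> itself: \<open>N\<close> corresponds to the complete summand, its complement to
  the isolated vertices.\<close>

lemma graph_iso_complete_isolated_iff:
  fixes G :: "'v ugraph"
  assumes G: "simple_graph G"
  shows "graph_iso G (disjoint_sum (complete_graph n)
      (disjoint_family_sum {1..t::nat} (\<lambda>_. complete_graph 1))) \<longleftrightarrow>
    (\<exists>N\<subseteq>verts G. card N = n \<and> card (verts G - N) = t \<and> edges G = {e. e \<subseteq> N \<and> card e = 2})"
    (is "graph_iso G ?H \<longleftrightarrow> _")
proof
  have edge_iff: "{p, q} \<in> edges ?H \<longleftrightarrow> (\<exists>i<n. \<exists>j<n. i \<noteq> j \<and> p = Inl i \<and> q = Inl j)" for p q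
  proof -
    have "edges ?H = {Inl ` {i, j} | i j. i < n \<and> j < n \<and> i \<noteq> j}"
      unfolding edges_disjoint_sum_isolated edges_complete_graph by blast
    then have "{p, q} \<in> edges ?H \<longleftrightarrow>
        (\<exists>i j. {p, q} = {Inl i, Inl j} \<and> i < n \<and> j < n \<and> i \<noteq> j)"
      by simp
    also have "\<dots> \<longleftrightarrow> (\<exists>i<n. \<exists>j<n. i \<noteq> j \<and> p = Inl i \<and> q = Inl j)"
      unfolding doubleton_eq_iff by blast
    finally show ?thesis .
  qed
  have verts_eq: "verts ?H = Inl ` {..<n} \<union> Inr ` ({1..t} \<times> {0})"
    unfolding verts_disjoint_sum_isolated by (simp add: complete_graph_def)
  have fin: "finite (verts G)"
    using G by (simp add: simple_graph_def)
  {
    assume "graph_iso G ?H"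
    then obtain f where f: "bij_betw f (verts G) (verts ?H)"
      and iso: "\<And>u v. u \<in> verts G \<Longrightarrow> v \<in> verts G \<Longrightarrow>
        {u, v} \<in> edges G \<longleftrightarrow> {f u, f v} \<in> edges ?H"
      unfolding graph_iso_def by blast
    define N where "N = {v \<in> verts G. f v \<in> Inl ` {..<n}}"
    have im: "f ` verts G = Inl ` {..<n} \<union> Inr ` ({1..t} \<times> {0})"
      using f unfolding verts_eq by (simp add: bij_betw_def)
    have inj: "inj_on f (verts G)"
      using f by (simp add: bij_betw_def)
    have "f ` N = f ` verts G \<inter> Inl ` {..<n}"
      unfolding N_def by blast
    then have image_N: "f ` N = Inl ` {..<n}"
      unfolding im by blast
    then have "card N = n"
      using card_image[of f N] inj_on_subset[OF inj, of N] by (simp add: N_def card_image)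
    moreover have "f ` (verts G - N) = f ` verts G - f ` N"
      by (rule inj_on_image_set_diff[OF inj]) (auto simp: N_def)
    then have "f ` (verts G - N) = Inr ` ({1..t} \<times> {0})"
      unfolding im image_N by blast
    then have "card (verts G - N) = t"
      using card_image[of f "verts G - N"] inj_on_subset[OF inj, of "verts G - N"]
      by (simp add: card_image card_cartesian_product)
    moreover have adj: "{u, v} \<in> edges G \<longleftrightarrow> u \<in> N \<and> v \<in> N \<and> u \<noteq> v"
      if "u \<in> verts G" "v \<in> verts G" for u v
    proof -
      \<comment> \<open>Injectivity of \<open>f\<close> turns distinctness of the images, as
        demanded by \<open>edge_iff\<close>, into distinctness of \<open>u\<close> and
        \<open>v\<close>.\<close>
      have "u = v \<longleftrightarrow> f u = f v"
        using inj_on_eq_iff[OF inj that] by simp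
      then show ?thesis
        unfolding iso[OF that] edge_iff using that by (auto simp: N_def)
    qed
    have "edges G = {e. e \<subseteq> N \<and> card e = 2}"
    proof (intro Set.set_eqI iffI)
      fix e assume "e \<in> edges G"
      then obtain u v where "e = {u, v}" "u \<noteq> v" "u \<in> verts G" "v \<in> verts G"
        by (rule edgeE[OF G])
      with adj[of u v] \<open>e \<in> edges G\<close> show "e \<in> {e. e \<subseteq> N \<and> card e = 2}"
        by simp
    next
      fix e assume "e \<in> {e. e \<subseteq> N \<and> card e = 2}"
      then show "e \<in> edges G"
        using adj by (auto simp: card_2_iff N_def)
    qed
    moreover have "N \<subseteq> verts G" by (auto simp: N_def)
    ultimately show "\<exists>N\<subseteq>verts G. card N = n \<and> card (verts G - N) = t \<and>
      edges G = {e. e \<subseteq> N \<and> card e = 2}" by blast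
  }
  {
    assume "\<exists>N\<subseteq>verts G. card N = n \<and> card (verts G - N) = t \<and>
      edges G = {e. e \<subseteq> N \<and> card e = 2}"
    then obtain N where N: "N \<subseteq> verts G" "card N = n" "card (verts G - N) = t"
      "edges G = {e. e \<subseteq> N \<and> card e = 2}" by blast
    obtain g where g: "bij_betw g N {..<n}"
      using N(1,2) fin by (metis finite_same_card_bij card_lessThan finite_lessThan finite_subset)
    obtain h where h: "bij_betw h (verts G - N) {1..t}"
      using N(3) fin by (metis finite_same_card_bij card_atLeastAtMost diff_Suc_1 finite_Diff finite_atLeastAtMost)
    \<comment> \<open>The second component is \<open>0\<close> because that is the only vertex of
      \<open>complete_graph 1\<close>; \<open>h\<close> picks the copy.\<close>
    define f where "f v = (if v \<in> N then Inl (g v) else Inr (h v, 0::nat))" for v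
    have "bij_betw f N (Inl ` {..<n})"
      using g by (auto simp: bij_betw_def inj_on_def f_def image_iff)
    moreover have "bij_betw f (verts G - N) (Inr ` ({1..t} \<times> {0}))"
      using h by (auto simp: bij_betw_def inj_on_def f_def image_iff)
    ultimately have "bij_betw f (N \<union> (verts G - N)) (Inl ` {..<n} \<union> Inr ` ({1..t} \<times> {0}))"
      by (rule bij_betw_combine) auto
    then have "bij_betw f (verts G) (verts ?H)"
      using N(1) unfolding verts_eq by (simp add: Un_absorb1)
    moreover have "{u, v} \<in> edges G \<longleftrightarrow> {f u, f v} \<in> edges ?H"
      if "u \<in> verts G" "v \<in> verts G" for u v
    proof -
      have "{f u, f v} \<in> edges ?H \<longleftrightarrow> u \<in> N \<and> v \<in> N \<and> u \<noteq> v"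
        unfolding edge_iff using g by (auto simp: f_def bij_betw_def inj_on_def)
      then show ?thesis
        by (auto simp: N(4) card_2_iff doubleton_eq_iff)
    qed
    ultimately show "graph_iso G ?H"
      unfolding graph_iso_def by blast
  }
qed

text \<open>Distinct vertices are adjacent. The contrapositive shows that a complete graph on the
  non-isolated vertices of a disconnected graph leaves out some vertex.\<close>

lemma connected_graph_if_complete:
  assumes "edges G = {e. e \<subseteq> verts G \<and> card e = 2}"
  shows "connected_graph G"
proof -
  have "(u, v) \<in> {(x, y). {x, y} \<in> edges G}\<^sup>*" if "u \<in> verts G" "v \<in> verts G" for u v
    using that by (cases "u = v") (auto simp: assms intro!: r_into_rtrancl)
  then show ?thesis
    by (simp add: connected_graph_def)
qed

theorem proposition6p8:
  fixes G :: "'v ugraph"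
  assumes "simple_graph G"
    and "\<not> connected_graph G"
    and "card (edges G) \<ge> 1"
  defines "I \<equiv> (cut_ideal G :: ('v set set, 'k::field) polynomial set)"
  shows "(generated_in_single_degree (unordered_partitions (verts G)) I \<longleftrightarrow>
           generated_by_linear_forms (unordered_partitions (verts G)) I) \<and>
         (generated_by_linear_forms (unordered_partitions (verts G)) I \<longleftrightarrow>
           (\<exists>t\<ge>1. graph_iso G (disjoint_sum (complete_graph 2)
                      (disjoint_family_sum {1..t::nat} (\<lambda>_. complete_graph 1))) \<or>
                  graph_iso G (disjoint_sum (complete_graph 3)
                      (disjoint_family_sum {1..t} (\<lambda>_. complete_graph 1)))))"
proof (intro conjI)
  have edges: "edges G \<noteq> {}"
    using assms(3) by auto
  show "generated_in_single_degree (unordered_partitions (verts G)) I \<longleftrightarrow>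
      generated_by_linear_forms (unordered_partitions (verts G)) I"
  proof
    assume "generated_in_single_degree (unordered_partitions (verts G)) I"
    then show "generated_by_linear_forms (unordered_partitions (verts G)) I"
      unfolding I_def by (rule single_degree_imp_linear[OF assms(1,2)])
  next
    assume "generated_by_linear_forms (unordered_partitions (verts G)) I"
    then show "generated_in_single_degree (unordered_partitions (verts G)) I"
      unfolding generated_by_linear_forms_def generated_in_single_degree_def linear_form_def
      by blast
  qed
  let ?K = "\<lambda>N. edges G = {e. e \<subseteq> N \<and> card e = 2}"
  have "generated_by_linear_forms (unordered_partitions (verts G)) I \<longleftrightarrow>
      (\<exists>N\<subseteq>verts G. card N \<in> {2, 3} \<and> ?K N)"
  proof
    assume "generated_by_linear_forms (unordered_partitions (verts G)) I"
    then show "\<exists>N\<subseteq>verts G. card N \<in> {2, 3} \<and> ?K N"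
      unfolding I_def by (rule linear_imp_complete_on_support[OF assms(1) edges])
  next
    assume "\<exists>N\<subseteq>verts G. card N \<in> {2, 3} \<and> ?K N"
    then show "generated_by_linear_forms (unordered_partitions (verts G)) I"
      unfolding I_def by (elim exE conjE) (rule complete_on_support_imp_linear[OF assms(1)])
  qed
  also have "\<dots> \<longleftrightarrow>
      (\<exists>N\<subseteq>verts G. card N \<in> {2, 3} \<and> 1 \<le> card (verts G - N) \<and> ?K N)"
  proof -
    \<comment> \<open>Disconnectedness enters here: it provides at least one isolated vertex, that
      is, \<open>t\<close> at least 1.\<close>
    have "1 \<le> card (verts G - N)" if "N \<subseteq> verts G" "?K N" for N
    proof -
      have "N \<noteq> verts G"
        using connected_graph_if_complete[of G] that(2) assms(2) by auto
      then have "verts G - N \<noteq> {}"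
        using that(1) by auto
      then show ?thesis
        using assms(1) by (simp add: simple_graph_def Suc_le_eq card_gt_0_iff)
    qed
    then show ?thesis by (metis (no_types, lifting))
  qed
  also have "\<dots> \<longleftrightarrow> (\<exists>t\<ge>1.
      (\<exists>N\<subseteq>verts G. card N = 2 \<and> card (verts G - N) = t \<and> ?K N) \<or>
      (\<exists>N\<subseteq>verts G. card N = 3 \<and> card (verts G - N) = t \<and> ?K N))"
    by auto
  finally show "generated_by_linear_forms (unordered_partitions (verts G)) I \<longleftrightarrow>
      (\<exists>t\<ge>1. graph_iso G (disjoint_sum (complete_graph 2)
                  (disjoint_family_sum {1..t::nat} (\<lambda>_. complete_graph 1))) \<or>
              graph_iso G (disjoint_sum (complete_graph 3)
                  (disjoint_family_sum {1..t} (\<lambda>_. complete_graph 1))))"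
    unfolding graph_iso_complete_isolated_iff[OF assms(1)] .
qed

end
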